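(* Let $(m_{-\infty},m_\infty,n_{-\infty},n_\infty)\in\mathbb{R}^4$ satisfy $m_{-\infty}<m_\infty$ and $n_\infty<n_{-\infty}$, and let $m_*\le m_{-\infty}$, $n_*\le n_\infty$ be real. (1) If a time-invariant strategy pair $\{(b_i,a_i):i\in\mathbb{Z}\}$ is a Nash equilibrium of $\mathrm{Trail}(m_{-\infty},m_\infty,n_{-\infty},n_\infty)$, then the associated quadruple $\{(a_i,b_i,m_i,n_i):i\in\mathbb{Z}\}$ is a positive ABMN solution with boundary data $(m_{-\infty},m_\infty,n_{-\infty},n_\infty)$. (2) Conversely, if $\{(a_i,b_i,m_i,n_i)\in(0,\infty)^2\times\mathbb{R}^2:i\in\mathbb{Z}\}$ is a positive ABMN solution with boundary data $(m_{-\infty},m_\infty,n_{-\infty},n_\infty)$, then the time-invariant strategy pair $\{(b_i,a_i):i\in\mathbb{Z}\}$ (Mina stakes $b_i$, Maxine stakes $a_i$ at site $i$) is a Nash equilibrium of $\mathrm{Trail}(m_{-\infty},m_\infty,n_{-\infty},n_\infty)$.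
   Context: Trail of Lost Pennies $\mathrm{Trail}(m_{-\infty},m_\infty,n_{-\infty},n_\infty)$: the data satisfy $m_{-\infty}<m_\infty$, $n_\infty<n_{-\infty}$, and fixed reals $m_*\le m_{-\infty}$, $n_*\le n_\infty$. A strategy is a map $S:\mathbb{Z}\times\mathbb{N}_+\to[0,\infty)$; it is time-invariant if $S(i,j)$ does not depend on $j$. For a strategy pair $(S_-,S_+)$ (Mina's, Maxine's) and $k\in\mathbb{Z}$, gameplay is the random process $X:\mathbb{N}\to\mathbb{Z}$ with $X_0=k$ such that, given $X_0,\dots,X_{i-1}$, $X_i=X_{i-1}+1$ with probability $\frac{S_+(X_{i-1},i)}{S_-(X_{i-1},i)+S_+(X_{i-1},i)}$ and $X_i=X_{i-1}-1$ otherwise (with the convention $0/0=1/2$). Let $E_-=\{\limsup_n X_n=-\infty\}$, $E_+=\{\liminf_nX_n=\infty\}$, $E=E_-\cup E_+$. Mina's payoff is $P_-=-\sum_{t\ge1}S_-(X_{t-1},t)+T_-$ with $T_-=n_{-\infty}$ on $E_-$, $n_\infty$ on $E_+$, $n_*$ on $E^c$; Maxine's payoff is $P_+=-\sum_{t\ge1}S_+(X_{t-1},t)+T_+$ with $T_+=m_{-\infty}$ on $E_-$, $m_\infty$ on $E_+$, $m_*$ on $E^c$. Write $\mathbb{E}^k_{S_-,S_+}$ for expectation (values in $\mathbb{R}\cup\{-\infty\}$ allowed). $(S_-,S_+)$ is a Nash equilibrium if for every strategy $S$ and every $k\in\mathbb{Z}$: $\mathbb{E}^k_{S_-,S_+}[P_+]\ge\mathbb{E}^k_{S_-,S}[P_+]$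 and $\mathbb{E}^k_{S_-,S_+}[P_-]\ge\mathbb{E}^k_{S,S_+}[P_-]$ (alternative strategies need not be time-invariant). A time-invariant pair is identified with sequences $\{(b_i,a_i)\}$, $b_i=S_-(i,\cdot)$, $a_i=S_+(i,\cdot)$; its associated quadruple is $\{(a_i,b_i,m_i,n_i)\}$ with $m_i=\mathbb{E}^i_{S_-,S_+}[P_+]$, $n_i=\mathbb{E}^i_{S_-,S_+}[P_-]$. The ABMN system on $\mathbb{Z}$: real variables $a_i,b_i\ge0$, $m_i,n_i$ with, for every $i$, $(a_i+b_i)(m_i+a_i)=a_im_{i+1}+b_im_{i-1}$; $(a_i+b_i)(n_i+b_i)=a_in_{i+1}+b_in_{i-1}$; $(a_i+b_i)^2=b_i(m_{i+1}-m_{i-1})$; $(a_i+b_i)^2=a_i(n_{i-1}-n_{i+1})$. Positive means $a_i,b_i>0$ for all $i$; boundary data $(m_{-\infty},m_\infty,n_{-\infty},n_\infty)$ are the limits of $m_{-k},m_k,n_{-k},n_k$ as $k\to\infty$. *)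

theory Defs
  imports "HOL-Probability.Probability"
begin

text \<open>Strategies: maps Z x N+ -> [0,oo). We use int => nat => real and only
  the values at times j >= 1 matter.\<close>
definition strategy :: "(int \<Rightarrow> nat \<Rightarrow> real) \<Rightarrow> bool" where
  "strategy S \<longleftrightarrow> (\<forall>i j. 0 < j \<longrightarrow> 0 \<le> S i j)"

definition up_prob :: "(int \<Rightarrow> nat \<Rightarrow> real) \<Rightarrow> (int \<Rightarrow> nat \<Rightarrow> real) \<Rightarrow> int \<Rightarrow> nat \<Rightarrow> real" where
  "up_prob Sm Sp x t =
     (if Sm x t + Sp x t = 0 then 1/2 else Sp x t / (Sm x t + Sp x t))"

text \<open>Canonical realisation of gameplay: driven by i.i.d. uniform [0,1] variables
  omega 1, omega 2, ...; step i goes up iff omega i < up_prob at (X (i-1), i).\<close>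
definition game_space :: "(nat \<Rightarrow> real) measure" where
  "game_space = PiM UNIV (\<lambda>_::nat. uniform_measure lborel {0..1::real})"

fun gameplay :: "(int \<Rightarrow> nat \<Rightarrow> real) \<Rightarrow> (int \<Rightarrow> nat \<Rightarrow> real) \<Rightarrow> int \<Rightarrow> (nat \<Rightarrow> real) \<Rightarrow> nat \<Rightarrow> int" where
  "gameplay Sm Sp k \<omega> 0 = k"
| "gameplay Sm Sp k \<omega> (Suc i) =
     gameplay Sm Sp k \<omega> i +
     (if \<omega> (Suc i) < up_prob Sm Sp (gameplay Sm Sp k \<omega> i) (Suc i) then 1 else -1)"

definition terminal :: "real \<Rightarrow> real \<Rightarrow> real \<Rightarrow> (nat \<Rightarrow> int) \<Rightarrow> real" where
  "terminal v_minus v_plus v_star X =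
     (if limsup (\<lambda>n. ereal (real_of_int (X n))) = -\<infinity> then v_minus
      else if liminf (\<lambda>n. ereal (real_of_int (X n))) = \<infinity> then v_plus
      else v_star)"

definition exp_payoff ::
  "(int \<Rightarrow> nat \<Rightarrow> real) \<Rightarrow> real \<Rightarrow> real \<Rightarrow> real \<Rightarrow>
   (int \<Rightarrow> nat \<Rightarrow> real) \<Rightarrow> (int \<Rightarrow> nat \<Rightarrow> real) \<Rightarrow> int \<Rightarrow> ereal" where
  "exp_payoff own v_minus v_plus v_star Sm Sp k =
     ereal (\<integral>\<omega>. terminal v_minus v_plus v_star (gameplay Sm Sp k \<omega>) \<partial>game_space)
     - enn2ereal (\<integral>\<^sup>+\<omega>. (\<Sum>t. ennreal (own (gameplay Sm Sp k \<omega> t) (Suc t))) \<partial>game_space)"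

definition maxine_payoff ::
  "real \<Rightarrow> real \<Rightarrow> real \<Rightarrow> (int \<Rightarrow> nat \<Rightarrow> real) \<Rightarrow> (int \<Rightarrow> nat \<Rightarrow> real) \<Rightarrow> int \<Rightarrow> ereal" where
  "maxine_payoff m_minf m_inf m_star Sm Sp k = exp_payoff Sp m_minf m_inf m_star Sm Sp k"

definition mina_payoff ::
  "real \<Rightarrow> real \<Rightarrow> real \<Rightarrow> (int \<Rightarrow> nat \<Rightarrow> real) \<Rightarrow> (int \<Rightarrow> nat \<Rightarrow> real) \<Rightarrow> int \<Rightarrow> ereal" where
  "mina_payoff n_minf n_inf n_star Sm Sp k = exp_payoff Sm n_minf n_inf n_star Sm Sp k"

definition nash_equilibrium ::
  "real \<Rightarrow> real \<Rightarrow> real \<Rightarrow> real \<Rightarrow> real \<Rightarrow> real \<Rightarrow>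
   (int \<Rightarrow> nat \<Rightarrow> real) \<Rightarrow> (int \<Rightarrow> nat \<Rightarrow> real) \<Rightarrow> bool" where
  "nash_equilibrium m_minf m_inf n_minf n_inf m_star n_star Sm Sp \<longleftrightarrow>
     (\<forall>S k. strategy S \<longrightarrow>
        maxine_payoff m_minf m_inf m_star Sm S k \<le> maxine_payoff m_minf m_inf m_star Sm Sp k \<and>
        mina_payoff n_minf n_inf n_star S Sp k \<le> mina_payoff n_minf n_inf n_star Sm Sp k)"

definition ABMN :: "(int \<Rightarrow> real) \<Rightarrow> (int \<Rightarrow> real) \<Rightarrow> (int \<Rightarrow> real) \<Rightarrow> (int \<Rightarrow> real) \<Rightarrow> bool" where
  "ABMN a b m n \<longleftrightarrow> (\<forall>i.
     0 \<le> a i \<and> 0 \<le> b i \<and>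
     (a i + b i) * (m i + a i) = a i * m (i + 1) + b i * m (i - 1) \<and>
     (a i + b i) * (n i + b i) = a i * n (i + 1) + b i * n (i - 1) \<and>
     (a i + b i)^2 = b i * (m (i + 1) - m (i - 1)) \<and>
     (a i + b i)^2 = a i * (n (i - 1) - n (i + 1)))"

definition positive_ABMN :: "(int \<Rightarrow> real) \<Rightarrow> (int \<Rightarrow> real) \<Rightarrow> (int \<Rightarrow> real) \<Rightarrow> (int \<Rightarrow> real) \<Rightarrow> bool" where
  "positive_ABMN a b m n \<longleftrightarrow> ABMN a b m n \<and> (\<forall>i. 0 < a i \<and> 0 < b i)"

definition boundary_data ::
  "(int \<Rightarrow> real) \<Rightarrow> (int \<Rightarrow> real) \<Rightarrow> real \<Rightarrow> real \<Rightarrow> real \<Rightarrow> real \<Rightarrow> bool" where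
  "boundary_data m n m_minf m_inf n_minf n_inf \<longleftrightarrow>
     (\<lambda>k::nat. m (- int k)) \<longlonglongrightarrow> m_minf \<and> (\<lambda>k::nat. m (int k)) \<longlonglongrightarrow> m_inf \<and>
     (\<lambda>k::nat. n (- int k)) \<longlonglongrightarrow> n_minf \<and> (\<lambda>k::nat. n (int k)) \<longlonglongrightarrow> n_inf"

end

theory Submission
  imports Defs
begin

text \<open>
  A positive ABMN solution says that each player's value sequence is superharmonic, up to that
  player's own stake, against every one-round stake, and harmonic for the prescribed one. Fatou's
  lemma therefore bounds the payoff of any deviation by the value. For the prescribed pair the
  expected total stake is finite while every site costs a positive amount, so almost surely no
  site is visited infinitely often and the path escapes; dominated convergence then identifies
  the payoff with the value.

  Conversely, optimality against one-shot deviations gives the ABMN equations at every site where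
  both stakes are positive. A single vanishing stake forces all stakes to vanish, and the zero pair
  loses to a player who stakes an arbitrarily small geometric sequence. For the boundary data,
  let \<open>h k\<close> be the probability of escaping to the right from \<open>k\<close>. The value at \<open>k\<close>
  computed with the limits of the value sequence as terminal payments agrees with the value computed
  with the given terminal payments, so two affine functions agree at all \<open>h k\<close>. They coincide
  unless \<open>h\<close> is constant, and a constant \<open>h\<close> would have to be at least 1 for Maxine's sake
  and at most 0 for Mina's.
\<close>

section \<open>The driving sequence and the first step of gameplay\<close>

abbreviation unit_uniform :: "real measure" where
  "unit_uniform \<equiv> uniform_measure lborel {0..1::real}"

abbreviation path_space :: "(nat \<Rightarrow> int) measure" where
  "path_space \<equiv> PiM UNIV (\<lambda>_::nat. count_space (UNIV :: int set))"

lemma prob_space_unit_uniform: "prob_space unit_uniform"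
  by (rule prob_space_uniform_measure) auto

lemma prob_space_game_space: "prob_space game_space"
  unfolding game_space_def by (rule prob_space_PiM) (rule prob_space_unit_uniform)

lemma sets_game_space: "sets game_space = sets (PiM UNIV (\<lambda>_. borel))"
  unfolding game_space_def by (rule sets_PiM_cong) auto

text \<open>An i.i.d. sequence is a first coordinate followed by an independent copy of the whole
  sequence (\<open>PiM_iter\<close>), and Tonelli's theorem separates the two. Nonnegative integrals
  are used because total stakes may have infinite mean.\<close>

lemma nn_integral_game_space_case_nat:
  assumes "F \<in> borel_measurable game_space"
  shows "(\<integral>\<^sup>+\<omega>. F \<omega> \<partial>game_space)
    = (\<integral>\<^sup>+x. \<integral>\<^sup>+\<omega>. F (case_nat x \<omega>) \<partial>game_space \<partial>unit_uniform)"
proof -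
  interpret U: prob_space unit_uniform by (rule prob_space_unit_uniform)
  interpret G: prob_space game_space by (rule prob_space_game_space)
  interpret sequence_space unit_uniform
    by unfold_locales
  have F [measurable]: "F \<in> borel_measurable S" using assms by (simp add: game_space_def)
  have [measurable]: "(\<lambda>(s, \<omega>). case_nat s \<omega>) \<in> measurable (unit_uniform \<Otimes>\<^sub>M S) S"
    by measurable
  have "(\<integral>\<^sup>+\<omega>. F \<omega> \<partial>S) = (\<integral>\<^sup>+\<omega>. F \<omega> \<partial>distr (unit_uniform \<Otimes>\<^sub>M S) S (\<lambda>(s, \<omega>). case_nat s \<omega>))"
    by (simp add: PiM_iter)
  also have "\<dots> = (\<integral>\<^sup>+z. F (case z of (s, \<omega>) \<Rightarrow> case_nat s \<omega>) \<partial>(unit_uniform \<Otimes>\<^sub>M S))"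
    by (intro nn_integral_distr) measurable
  also have "\<dots> = (\<integral>\<^sup>+x. \<integral>\<^sup>+\<omega>. F (case_nat x \<omega>) \<partial>S \<partial>unit_uniform)"
  proof -
    have "(\<lambda>z. F (case z of (s, \<omega>) \<Rightarrow> case_nat s \<omega>)) \<in> borel_measurable (unit_uniform \<Otimes>\<^sub>M S)"
      by measurable
    from G.nn_integral_fst[unfolded game_space_def, OF this] show ?thesis by simp
  qed
  finally show ?thesis by (simp add: game_space_def)
qed

lemma emeasure_unit_uniform_lessThan:
  assumes "0 \<le> p" "p \<le> 1"
  shows "emeasure unit_uniform {..<p} = ennreal p"
proof -
  have "{0..1} \<inter> {..<p} = {0..<p}" using assms by auto
  then show ?thesis using assms by (simp add: divide_ennreal flip: ennreal_1)
qed

lemma nn_integral_unit_uniform_if: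
  assumes "0 \<le> p" "p \<le> 1"
  shows "(\<integral>\<^sup>+x. (if x < p then A else B) \<partial>unit_uniform) = ennreal p * A + ennreal (1 - p) * B"
proof -
  interpret U: prob_space unit_uniform by (rule prob_space_unit_uniform)
  have "emeasure unit_uniform (- {..<p}) = ennreal (1 - p)"
    using emeasure_compl[of "{..<p}" unit_uniform] assms emeasure_unit_uniform_lessThan[OF assms] U.emeasure_space_1
    by (simp add: Compl_eq_Diff_UNIV ennreal_minus flip: ennreal_1)
  moreover have "(\<integral>\<^sup>+x. (if x < p then A else B) \<partial>unit_uniform)
    = (\<integral>\<^sup>+x. A * indicator {..<p} x + B * indicator (- {..<p}) x \<partial>unit_uniform)"
    by (intro nn_integral_cong) (auto simp: indicator_def)
  ultimately show ?thesis
    using emeasure_unit_uniform_lessThan[OF assms]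
    by (simp add: nn_integral_add nn_integral_cmult_indicator mult.commute)
qed

lemma measurable_gameplay_coord [measurable]:
  "(\<lambda>\<omega>. gameplay Sm Sp k \<omega> n) \<in> measurable game_space (count_space UNIV)"
proof (induction n)
  case (Suc n)
  \<comment> \<open>The current site takes countably many values, so it suffices to treat the next
    position for each fixed site \<open>x\<close>.\<close>
  have *: "(\<lambda>\<omega>. x + (if \<omega> (Suc n) < up_prob Sm Sp x (Suc n) then 1 else -1))
      \<in> measurable game_space (count_space UNIV)" for x :: int
  proof -
    have [measurable]: "(\<lambda>\<omega>. \<omega> (Suc n)) \<in> borel_measurable game_space"
      unfolding measurable_cong_sets[OF sets_game_space refl] by measurable
    show ?thesis by measurable
  qed
  show ?case
    using measurable_compose_countable[OF * Suc] by simp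
qed simp

lemma measurable_gameplay [measurable]:
  "gameplay Sm Sp k \<in> measurable game_space path_space"
proof -
  have "(\<lambda>\<omega> n. gameplay Sm Sp k \<omega> n) \<in> measurable game_space path_space"
    by (rule measurable_PiM_single') auto
  then show ?thesis by simp
qed

lemma gameplay_cong:
  assumes "\<And>i j. 0 < j \<Longrightarrow> Sm' i j = Sm i j" "\<And>i j. 0 < j \<Longrightarrow> Sp' i j = Sp i j"
    and "\<And>j. 0 < j \<Longrightarrow> \<omega>' j = \<omega> j"
  shows "gameplay Sm' Sp' k \<omega>' n = gameplay Sm Sp k \<omega> n"
  by (induction n) (simp_all add: up_prob_def assms)

text \<open>What follows the first step is again gameplay, with strategies and driving variables
  moved by one time unit. Agreement is asked only at positive times: a one-shot deviation at time 1
  then shifts to the original time-invariant strategy, although the two differ at index 0.\<close>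

lemma gameplay_Suc_shift:
  assumes "\<And>i j. 0 < j \<Longrightarrow> Sm' i j = Sm i (Suc j)" "\<And>i j. 0 < j \<Longrightarrow> Sp' i j = Sp i (Suc j)"
    and "\<And>j. 0 < j \<Longrightarrow> \<omega>' j = \<omega> (Suc j)"
  shows "gameplay Sm Sp k \<omega> (Suc n) = gameplay Sm' Sp'
    (k + (if \<omega> (Suc 0) < up_prob Sm Sp k (Suc 0) then 1 else -1)) \<omega>' n"
proof (induction n)
  case (Suc n)
  have up: "up_prob Sm' Sp' i (Suc n) = up_prob Sm Sp i (Suc (Suc n))" for i
    by (simp add: up_prob_def assms)
  show ?case
    unfolding gameplay.simps(2)[of Sm Sp k \<omega> "Suc n"] gameplay.simps(2)[of Sm' Sp' _ \<omega>' n]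
      Suc.IH up by (simp add: assms(3))
qed simp

lemma up_prob_bounds:
  assumes "strategy Sm" "strategy Sp" "0 < t"
  shows "0 \<le> up_prob Sm Sp i t" "up_prob Sm Sp i t \<le> 1"
proof -
  have "0 \<le> Sm i t" "0 \<le> Sp i t" using assms by (auto simp: strategy_def)
  then show "0 \<le> up_prob Sm Sp i t" "up_prob Sm Sp i t \<le> 1"
    by (auto simp: up_prob_def divide_le_eq_1)
qed

text \<open>Gameplay never reads the coordinate \<open>0\<close> of the driving sequence.\<close>

lemma nn_integral_gameplay_drop_first:
  assumes "F \<in> borel_measurable path_space"
  shows "(\<integral>\<^sup>+\<omega>. F (gameplay Sm Sp k \<omega>) \<partial>game_space)
    = (\<integral>\<^sup>+\<omega>. F (gameplay Sm Sp k (case_nat 0 \<omega>)) \<partial>game_space)"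
proof -
  interpret U: prob_space unit_uniform by (rule prob_space_unit_uniform)
  note [measurable] = assms
  have "(\<integral>\<^sup>+\<omega>. F (gameplay Sm Sp k \<omega>) \<partial>game_space)
    = (\<integral>\<^sup>+x. \<integral>\<^sup>+\<omega>. F (gameplay Sm Sp k (case_nat x \<omega>)) \<partial>game_space \<partial>unit_uniform)"
    by (rule nn_integral_game_space_case_nat) measurable
  also have "\<dots>
    = (\<integral>\<^sup>+x. \<integral>\<^sup>+\<omega>. F (gameplay Sm Sp k (case_nat 0 \<omega>)) \<partial>game_space \<partial>unit_uniform)"
    by (intro nn_integral_cong arg_cong[where f = F] ext gameplay_cong) (auto split: nat.split)
  finally show ?thesis
    using U.emeasure_space_1 by simp
qed

text \<open>This is the Markov property at time 1. \<open>F\<close> may depend on the entire path,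
  so the formula serves single positions as well as terminal payments.\<close>

lemma nn_integral_gameplay_step:
  assumes S: "strategy Sm" "strategy Sp"
    and sh: "\<And>i j. 0 < j \<Longrightarrow> Sm' i j = Sm i (Suc j)" "\<And>i j. 0 < j \<Longrightarrow> Sp' i j = Sp i (Suc j)"
    and F [measurable]: "F \<in> borel_measurable path_space"
  shows "(\<integral>\<^sup>+\<omega>. F (gameplay Sm Sp k \<omega>) \<partial>game_space)
    = ennreal (up_prob Sm Sp k 1)
        * (\<integral>\<^sup>+\<omega>. F (case_nat k (gameplay Sm' Sp' (k + 1) \<omega>)) \<partial>game_space)
      + ennreal (1 - up_prob Sm Sp k 1)
        * (\<integral>\<^sup>+\<omega>. F (case_nat k (gameplay Sm' Sp' (k - 1) \<omega>)) \<partial>game_space)"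
proof -
  let ?p = "up_prob Sm Sp k 1"
  have case0: "(\<lambda>\<omega>. case_nat 0 \<omega>) \<in> measurable game_space game_space"
    unfolding measurable_cong_sets[OF sets_game_space sets_game_space]
    by (rule measurable_PiM_single') (auto split: nat.split simp: space_PiM)
  have casek: "(\<lambda>X. case_nat k X) \<in> measurable path_space path_space"
    by (rule measurable_PiM_single') (auto split: nat.split simp: space_PiM)
  have m0: "(\<lambda>\<omega>. F (gameplay Sm Sp k (case_nat 0 \<omega>))) \<in> borel_measurable game_space"
    by (rule measurable_compose[OF case0]) measurable
  have mk: "(\<lambda>X. F (case_nat k X)) \<in> borel_measurable path_space"
    by (rule measurable_compose[OF casek F])
  \<comment> \<open>Fixing coordinate 0 puts the split-off variable \<open>x\<close> at index 1,
    where it decides the first step. The remaining sequence is padded with a new coordinate 0, so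
    that its indices again start at time 1.\<close>
  have *: "gameplay Sm Sp k (case_nat 0 (case_nat x \<omega>)) =
      case_nat k (gameplay Sm' Sp' (if x < ?p then k + 1 else k - 1) (case_nat 0 \<omega>))" for x \<omega>
  proof
    fix n
    show "gameplay Sm Sp k (case_nat 0 (case_nat x \<omega>)) n =
      case_nat k (gameplay Sm' Sp' (if x < ?p then k + 1 else k - 1) (case_nat 0 \<omega>)) n"
    proof (cases n)
      case (Suc n')
      have "gameplay Sm Sp k (case_nat 0 (case_nat x \<omega>)) (Suc n') =
         gameplay Sm' Sp' (k + (if case_nat 0 (case_nat x \<omega>) (Suc 0) < up_prob Sm Sp k (Suc 0)
            then 1 else -1)) (case_nat 0 \<omega>) n'"
        by (rule gameplay_Suc_shift) (auto simp: sh split: nat.split)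
      then show ?thesis using Suc by simp
    qed simp
  qed
  have "(\<integral>\<^sup>+\<omega>. F (gameplay Sm Sp k \<omega>) \<partial>game_space)
    = (\<integral>\<^sup>+x. \<integral>\<^sup>+\<omega>. F (gameplay Sm Sp k (case_nat 0 (case_nat x \<omega>))) \<partial>game_space \<partial>unit_uniform)"
    unfolding nn_integral_gameplay_drop_first[OF F] by (rule nn_integral_game_space_case_nat[OF m0])
  also have "\<dots> = (\<integral>\<^sup>+x. (if x < ?p
      then \<integral>\<^sup>+\<omega>. F (case_nat k (gameplay Sm' Sp' (k + 1) (case_nat 0 \<omega>))) \<partial>game_space
      else \<integral>\<^sup>+\<omega>. F (case_nat k (gameplay Sm' Sp' (k - 1) (case_nat 0 \<omega>))) \<partial>game_space)
      \<partial>unit_uniform)"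
    unfolding * by (intro nn_integral_cong) auto
  also have "\<dots> = ennreal ?p
        * (\<integral>\<^sup>+\<omega>. F (case_nat k (gameplay Sm' Sp' (k + 1) (case_nat 0 \<omega>))) \<partial>game_space)
      + ennreal (1 - ?p)
        * (\<integral>\<^sup>+\<omega>. F (case_nat k (gameplay Sm' Sp' (k - 1) (case_nat 0 \<omega>))) \<partial>game_space)"
    by (rule nn_integral_unit_uniform_if) (simp_all add: up_prob_bounds[OF S])
  finally show ?thesis
    by (simp add: nn_integral_gameplay_drop_first[OF mk])
qed

section \<open>Escaping paths and terminal payoffs\<close>

lemma filterlim_real_of_int_at_top_iff:
  "filterlim (\<lambda>x. real_of_int (X x)) at_top F \<longleftrightarrow> filterlim X at_top F"
proof
  assume A: "filterlim (\<lambda>x. real_of_int (X x)) at_top F"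
  show "filterlim X at_top F"
    unfolding filterlim_at_top
  proof
    fix Z :: int
    have "\<forall>\<^sub>F x in F. real_of_int Z \<le> real_of_int (X x)"
      using A unfolding filterlim_at_top by blast
    then show "\<forall>\<^sub>F x in F. Z \<le> X x" by simp
  qed
next
  assume "filterlim X at_top F"
  then show "filterlim (\<lambda>x. real_of_int (X x)) at_top F"
    by (rule filterlim_compose[OF filterlim_real_of_int_at_top])
qed

lemma filterlim_int_at_bot_iff:
  fixes X :: "'a \<Rightarrow> int"
  shows "filterlim X at_bot F \<longleftrightarrow> filterlim (\<lambda>x. - X x) at_top F"
proof
  assume A: "filterlim X at_bot F"
  show "filterlim (\<lambda>x. - X x) at_top F"
    unfolding filterlim_at_top
  proof
    fix Z :: int
    have "\<forall>\<^sub>F x in F. X x \<le> - Z" using A unfolding filterlim_at_bot by blast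
    then show "\<forall>\<^sub>F x in F. Z \<le> - X x" by eventually_elim simp
  qed
next
  assume A: "filterlim (\<lambda>x. - X x) at_top F"
  show "filterlim X at_bot F"
    unfolding filterlim_at_bot
  proof
    fix Z :: int
    have "\<forall>\<^sub>F x in F. - Z \<le> - X x" using A unfolding filterlim_at_top by blast
    then show "\<forall>\<^sub>F x in F. X x \<le> Z" by eventually_elim simp
  qed
qed

text \<open>A limsup equal to minus infinity already forces divergence to minus infinity, and dually
  for the liminf. The escape events thus become limits of the integer path, which compose with
  limits of value sequences.\<close>

lemma terminal_filterlim:
  "terminal v_minus v_plus v_star X =
     (if filterlim X at_bot sequentially then v_minus
      else if filterlim X at_top sequentially then v_plus else v_star)"
proof -
  have "liminf (\<lambda>n. ereal (real_of_int (X n))) = \<infinity> \<longleftrightarrow> filterlim X at_top sequentially"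
    by (simp add: Liminf_PInfty[symmetric] tendsto_PInfty_eq_at_top filterlim_real_of_int_at_top_iff)
  moreover have "limsup (\<lambda>n. ereal (real_of_int (X n))) = -\<infinity> \<longleftrightarrow> filterlim X at_bot sequentially"
  proof -
    have "limsup (\<lambda>n. ereal (real_of_int (X n))) = -\<infinity>
      \<longleftrightarrow> ((\<lambda>n. ereal (real_of_int (X n))) \<longlongrightarrow> -\<infinity>) sequentially"
      by (simp add: Limsup_MInfty)
    also have "\<dots> \<longleftrightarrow> filterlim (\<lambda>n. real_of_int (X n)) at_bot sequentially"
      unfolding tendsto_MInfty filterlim_at_bot_dense by simp
    also have "\<dots> \<longleftrightarrow> filterlim (\<lambda>n. real_of_int (- X n)) at_top sequentially"
      by (simp add: filterlim_uminus_at_bot)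
    also have "\<dots> \<longleftrightarrow> filterlim X at_bot sequentially"
      unfolding filterlim_real_of_int_at_top_iff filterlim_int_at_bot_iff ..
    finally show ?thesis .
  qed
  ultimately show ?thesis by (simp add: terminal_def)
qed

lemma terminal_case_nat: "terminal v_minus v_plus v_star (case_nat k X) = terminal v_minus v_plus v_star X"
proof -
  have "filterlim (case_nat k X) F sequentially \<longleftrightarrow> filterlim X F sequentially" for F
    using filterlim_sequentially_Suc[of "case_nat k X" F] by simp
  then show ?thesis by (simp add: terminal_filterlim)
qed

lemma abs_terminal_le: "\<bar>terminal v_minus v_plus v_star X\<bar> \<le> \<bar>v_minus\<bar> + \<bar>v_plus\<bar> + \<bar>v_star\<bar>"
  by (simp add: terminal_def)

lemma borel_measurable_terminal [measurable]:
  "terminal v_minus v_plus v_star \<in> borel_measurable path_space"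
proof -
  have [measurable]: "(\<lambda>X. ereal (real_of_int (X n))) \<in> borel_measurable path_space" for n
  proof -
    have "(\<lambda>X. X n) \<in> measurable path_space (count_space UNIV)" by measurable
    from measurable_compose[OF this, of "\<lambda>i. ereal (real_of_int i)" borel] show ?thesis by simp
  qed
  show ?thesis unfolding terminal_def[abs_def] by measurable
qed

lemma integrable_terminal_gameplay:
  "integrable game_space (\<lambda>\<omega>. terminal v_minus v_plus v_star (gameplay Sm Sp k \<omega>))"
proof -
  interpret prob_space game_space by (rule prob_space_game_space)
  show ?thesis
    by (rule integrable_const_bound[where B = "\<bar>v_minus\<bar> + \<bar>v_plus\<bar> + \<bar>v_star\<bar>"])
      (auto simp: abs_terminal_le intro!: measurable_compose[OF measurable_gameplay])
qed

lemma tendsto_along_int_path_at_top: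
  fixes f :: "int \<Rightarrow> real"
  assumes "(\<lambda>k::nat. f (int k)) \<longlonglongrightarrow> v" "filterlim X at_top sequentially"
  shows "(\<lambda>n. f (X n)) \<longlonglongrightarrow> v"
proof -
  have "filterlim (\<lambda>n. nat (X n)) sequentially sequentially"
    using filterlim_compose[OF filterlim_nat_sequentially assms(2)] .
  from filterlim_compose[OF assms(1) this]
  have "(\<lambda>n. f (int (nat (X n)))) \<longlonglongrightarrow> v" .
  moreover have "\<forall>\<^sub>F n in sequentially. f (int (nat (X n))) = f (X n)"
  proof -
    have "\<forall>\<^sub>F n in sequentially. 0 \<le> X n" using assms(2) unfolding filterlim_at_top by blast
    then show ?thesis by eventually_elim simp
  qed
  ultimately show ?thesis by (rule Lim_transform_eventually)
qed

lemma tendsto_along_int_path_at_bot: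
  fixes f :: "int \<Rightarrow> real"
  assumes "(\<lambda>k::nat. f (- int k)) \<longlonglongrightarrow> v" "filterlim X at_bot sequentially"
  shows "(\<lambda>n. f (X n)) \<longlonglongrightarrow> v"
  using tendsto_along_int_path_at_top[of "\<lambda>i. f (- i)" v "\<lambda>n. - X n"] assms
  by (simp add: filterlim_int_at_bot_iff)

text \<open>Steps of size one cannot jump over 0, so the path stays positive once 0 has been left
  for good. Below any level only finitely many positive sites remain, and each of them is eventually
  abandoned.\<close>

lemma nearest_neighbour_path_at_top:
  fixes X :: "nat \<Rightarrow> int"
  assumes step: "\<And>t. X (Suc t) = X t + 1 \<or> X (Suc t) = X t - 1"
    and leave: "\<And>i. \<forall>\<^sub>F t in sequentially. X t \<noteq> i"
    and N: "\<And>t. t \<ge> N \<Longrightarrow> X t \<noteq> 0" and pos: "X N > 0"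
  shows "filterlim X at_top sequentially"
proof -
  have gt: "X t > 0" if "t \<ge> N" for t
    using that
  proof (induction t rule: dec_induct)
    case (step t)
    then show ?case using N[of "Suc t"] assms(1)[of t] by auto
  qed (rule pos)
  show ?thesis unfolding filterlim_at_top
  proof
    fix Z
    have "\<forall>\<^sub>F t in sequentially. \<forall>i\<in>{0..Z}. X t \<noteq> i"
      using leave by (intro eventually_ball_finite) auto
    moreover have "\<forall>\<^sub>F t in sequentially. X t > 0"
      using gt eventually_at_top_linorder by blast
    ultimately show "\<forall>\<^sub>F t in sequentially. Z \<le> X t"
      by eventually_elim (metis atLeastAtMost_iff less_imp_le linorder_linear)
  qed
qed

lemma nearest_neighbour_path_escapes:
  fixes X :: "nat \<Rightarrow> int"
  assumes step: "\<And>t. X (Suc t) = X t + 1 \<or> X (Suc t) = X t - 1"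
    and leave: "\<And>i. \<forall>\<^sub>F t in sequentially. X t \<noteq> i"
  shows "filterlim X at_bot sequentially \<or> filterlim X at_top sequentially"
proof -
  obtain N where N: "\<And>t. t \<ge> N \<Longrightarrow> X t \<noteq> 0"
    using leave[of 0] unfolding eventually_sequentially by auto
  show ?thesis
  proof (cases "X N > 0")
    case True
    from nearest_neighbour_path_at_top[OF step leave N True] show ?thesis by blast
  next
    case False
    then have "- X N > 0" using N[of N] by simp
    moreover have "- X (Suc t) = - X t + 1 \<or> - X (Suc t) = - X t - 1" for t
      using step[of t] by auto
    moreover have "\<forall>\<^sub>F t in sequentially. - X t \<noteq> i" for i
      using leave[of "- i"] by eventually_elim auto
    ultimately have "filterlim (\<lambda>t. - X t) at_top sequentially"
      using N by (intro nearest_neighbour_path_at_top[where N = N]) auto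
    then show ?thesis by (simp add: filterlim_int_at_bot_iff)
  qed
qed

text \<open>The terms of a convergent series tend to 0, so they eventually lie below the fixed
  positive number \<open>c i\<close>; from then on \<open>i\<close> is not visited. Positivity of
  \<open>c\<close> site by site suffices, without a uniform lower bound.\<close>

lemma finite_cost_path_escapes:
  fixes X :: "nat \<Rightarrow> int" and c :: "int \<Rightarrow> real"
  assumes step: "\<And>t. X (Suc t) = X t + 1 \<or> X (Suc t) = X t - 1"
    and c: "\<And>i. 0 < c i" and fin: "(\<Sum>t. ennreal (c (X t))) \<noteq> \<infinity>"
  shows "filterlim X at_bot sequentially \<or> filterlim X at_top sequentially"
proof (intro nearest_neighbour_path_escapes[of X] step)
  fix i
  have "summable (\<lambda>t. c (X t))"
    using fin c by (intro summable_suminf_not_top) (auto intro: less_imp_le)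
  then have "(\<lambda>t. c (X t)) \<longlonglongrightarrow> 0" by (rule summable_LIMSEQ_zero)
  then have "\<forall>\<^sub>F t in sequentially. c (X t) < c i"
    using c[of i] by (rule order_tendstoD)
  then show "\<forall>\<^sub>F t in sequentially. X t \<noteq> i" by eventually_elim auto
qed

section \<open>First-step analysis\<close>

lemma integral_gameplay_step:
  fixes \<Phi> :: "(nat \<Rightarrow> int) \<Rightarrow> real"
  assumes S: "strategy Sm" "strategy Sp"
    and sh: "\<And>i j. 0 < j \<Longrightarrow> Sm' i j = Sm i (Suc j)" "\<And>i j. 0 < j \<Longrightarrow> Sp' i j = Sp i (Suc j)"
    and \<Phi> [measurable]: "\<Phi> \<in> borel_measurable path_space" and B: "\<And>X. \<bar>\<Phi> X\<bar> \<le> B"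
    and tail: "\<And>X. \<Phi> (case_nat k X) = \<Phi> X"
  shows "(\<integral>\<omega>. \<Phi> (gameplay Sm Sp k \<omega>) \<partial>game_space)
    = up_prob Sm Sp k 1 * (\<integral>\<omega>. \<Phi> (gameplay Sm' Sp' (k + 1) \<omega>) \<partial>game_space)
      + (1 - up_prob Sm Sp k 1) * (\<integral>\<omega>. \<Phi> (gameplay Sm' Sp' (k - 1) \<omega>) \<partial>game_space)"
proof -
  interpret prob_space game_space by (rule prob_space_game_space)
  let ?p = "up_prob Sm Sp k 1"
  \<comment> \<open>Adding \<open>B\<close> makes the functional nonnegative, so the step formula
    for nonnegative integrals applies. The two weights sum to 1, hence \<open>B\<close> cancels at
    the end.\<close>
  have pos: "0 \<le> \<Phi> X + B" for X using B[of X] by linarith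
  have [measurable]: "(\<lambda>\<omega>. \<Phi> (gameplay Sm Sp k \<omega>)) \<in> borel_measurable game_space" for Sm Sp k
    by (rule measurable_compose[OF measurable_gameplay \<Phi>])
  have int: "integrable game_space (\<lambda>\<omega>. \<Phi> (gameplay Sm Sp k \<omega>))" for Sm Sp k
    by (rule integrable_const_bound[where B = B]) (auto simp: B)
  have E: "(\<integral>\<^sup>+\<omega>. ennreal (\<Phi> (gameplay Sm Sp k \<omega>) + B) \<partial>game_space)
      = ennreal ((\<integral>\<omega>. \<Phi> (gameplay Sm Sp k \<omega>) \<partial>game_space) + B)" for Sm Sp k
    by (subst nn_integral_eq_integral) (use int pos in \<open>auto simp: prob_space\<close>)
  have E0: "0 \<le> (\<integral>\<omega>. \<Phi> (gameplay Sm Sp k \<omega>) \<partial>game_space) + B" for Sm Sp k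
  proof -
    have "0 \<le> (\<integral>\<omega>. \<Phi> (gameplay Sm Sp k \<omega>) + B \<partial>game_space)" using pos by simp
    also have "\<dots> = (\<integral>\<omega>. \<Phi> (gameplay Sm Sp k \<omega>) \<partial>game_space) + B"
      using int by (simp add: prob_space)
    finally show ?thesis .
  qed
  have p: "0 \<le> ?p" "?p \<le> 1" by (simp_all add: up_prob_bounds[OF S])
  have "(\<integral>\<^sup>+\<omega>. ennreal (\<Phi> (gameplay Sm Sp k \<omega>) + B) \<partial>game_space)
    = ennreal ?p * (\<integral>\<^sup>+\<omega>. ennreal (\<Phi> (gameplay Sm' Sp' (k + 1) \<omega>) + B) \<partial>game_space)
      + ennreal (1 - ?p) * (\<integral>\<^sup>+\<omega>. ennreal (\<Phi> (gameplay Sm' Sp' (k - 1) \<omega>) + B) \<partial>game_space)"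
    using nn_integral_gameplay_step[OF S sh, of "\<lambda>X. ennreal (\<Phi> X + B)"] by (simp add: tail)
  then have "(\<integral>\<omega>. \<Phi> (gameplay Sm Sp k \<omega>) \<partial>game_space) + B
    = ?p * ((\<integral>\<omega>. \<Phi> (gameplay Sm' Sp' (k + 1) \<omega>) \<partial>game_space) + B)
      + (1 - ?p) * ((\<integral>\<omega>. \<Phi> (gameplay Sm' Sp' (k - 1) \<omega>) \<partial>game_space) + B)"
    using p E0 unfolding E
    by (simp add: ennreal_mult[symmetric] ennreal_plus[symmetric] del: ennreal_plus)
  then show ?thesis by (simp add: algebra_simps)
qed

lemma nn_integral_gameplay_Suc:
  assumes S: "strategy Sm" "strategy Sp"
    and sh: "\<And>i j. 0 < j \<Longrightarrow> Sm' i j = Sm i (Suc j)" "\<And>i j. 0 < j \<Longrightarrow> Sp' i j = Sp i (Suc j)"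
  shows "(\<integral>\<^sup>+\<omega>. G (gameplay Sm Sp k \<omega> (Suc T)) \<partial>game_space)
    = ennreal (up_prob Sm Sp k 1) * (\<integral>\<^sup>+\<omega>. G (gameplay Sm' Sp' (k + 1) \<omega> T) \<partial>game_space)
      + ennreal (1 - up_prob Sm Sp k 1) * (\<integral>\<^sup>+\<omega>. G (gameplay Sm' Sp' (k - 1) \<omega> T) \<partial>game_space)"
proof -
  have "(\<lambda>X. X (Suc T)) \<in> measurable path_space (count_space UNIV)" by measurable
  then have "(\<lambda>X. G (X (Suc T))) \<in> borel_measurable path_space"
    by (rule measurable_compose) simp
  from nn_integral_gameplay_step[OF S sh this, of k] sh show ?thesis by simp
qed

lemma suminf_ennreal_split_head: "(\<Sum>t. f t) = f 0 + (\<Sum>t. f (Suc t))" for f :: "nat \<Rightarrow> ennreal"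
  using sums_Suc[of f "\<Sum>t. f (Suc t)"] by (simp add: summable_sums sums_iff add.commute)

text \<open>Linearity reduces the total stake to the step formula for each single round. The
  infinite sum gives the recursion for payoffs; the finite sum drives inductions on the time
  horizon.\<close>

lemma nn_integral_stakes_step:
  fixes own :: "int \<Rightarrow> nat \<Rightarrow> ennreal"
  assumes S: "strategy Sm" "strategy Sp"
    and sh: "\<And>i j. 0 < j \<Longrightarrow> Sm' i j = Sm i (Suc j)" "\<And>i j. 0 < j \<Longrightarrow> Sp' i j = Sp i (Suc j)"
      "\<And>i j. 0 < j \<Longrightarrow> own' i j = own i (Suc j)"
  shows "(\<integral>\<^sup>+\<omega>. (\<Sum>t. own (gameplay Sm Sp k \<omega> t) (Suc t)) \<partial>game_space)
    = own k 1 + ennreal (up_prob Sm Sp k 1)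
        * (\<integral>\<^sup>+\<omega>. (\<Sum>t. own' (gameplay Sm' Sp' (k + 1) \<omega> t) (Suc t)) \<partial>game_space)
      + ennreal (1 - up_prob Sm Sp k 1)
        * (\<integral>\<^sup>+\<omega>. (\<Sum>t. own' (gameplay Sm' Sp' (k - 1) \<omega> t) (Suc t)) \<partial>game_space)" (is ?inf)
   and "(\<integral>\<^sup>+\<omega>. (\<Sum>t<Suc T. own (gameplay Sm Sp k \<omega> t) (Suc t)) \<partial>game_space)
    = own k 1 + ennreal (up_prob Sm Sp k 1)
        * (\<integral>\<^sup>+\<omega>. (\<Sum>t<T. own' (gameplay Sm' Sp' (k + 1) \<omega> t) (Suc t)) \<partial>game_space)
      + ennreal (1 - up_prob Sm Sp k 1)
        * (\<integral>\<^sup>+\<omega>. (\<Sum>t<T. own' (gameplay Sm' Sp' (k - 1) \<omega> t) (Suc t)) \<partial>game_space)" (is ?fin)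
proof -
  interpret prob_space game_space by (rule prob_space_game_space)
  have m: "(\<lambda>\<omega>. G (gameplay Sm Sp k \<omega> t)) \<in> borel_measurable game_space"
    for G :: "int \<Rightarrow> ennreal" and Sm Sp k t
    by (rule measurable_compose[OF measurable_gameplay_coord]) simp
  have step: "(\<integral>\<^sup>+\<omega>. own (gameplay Sm Sp k \<omega> (Suc t)) (Suc (Suc t)) \<partial>game_space)
    = ennreal (up_prob Sm Sp k 1) * (\<integral>\<^sup>+\<omega>. own' (gameplay Sm' Sp' (k + 1) \<omega> t) (Suc t) \<partial>game_space)
    + ennreal (1 - up_prob Sm Sp k 1) * (\<integral>\<^sup>+\<omega>. own' (gameplay Sm' Sp' (k - 1) \<omega> t) (Suc t) \<partial>game_space)" for t
    using nn_integral_gameplay_Suc[OF S sh(1,2), of "\<lambda>i. own i (Suc (Suc t))" k t] sh by simp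
  show ?inf
    unfolding nn_integral_suminf[OF m[of "\<lambda>i. own i (Suc t)" for t]]
      nn_integral_suminf[OF m[of "\<lambda>i. own' i (Suc t)" for t]]
    by (subst suminf_ennreal_split_head)
      (simp add: step suminf_add[symmetric] ennreal_suminf_cmult emeasure_space_1 add.assoc
        del: gameplay.simps(2))
  show ?fin
    unfolding nn_integral_sum[OF m[of "\<lambda>i. own i (Suc t)" for t]]
      nn_integral_sum[OF m[of "\<lambda>i. own' i (Suc t)" for t]]
    by (subst sum.lessThan_Suc_shift)
      (simp add: step sum.distrib sum_distrib_left[symmetric] emeasure_space_1 add.assoc
        del: gameplay.simps(2))
qed

section \<open>Expected payoffs\<close>

abbreviation mean_terminal where
  "mean_terminal v_minus v_plus v_star Sm Sp k \<equiv>
     (\<integral>\<omega>. terminal v_minus v_plus v_star (gameplay Sm Sp k \<omega>) \<partial>game_space)"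

abbreviation mean_stakes where
  "mean_stakes own Sm Sp k \<equiv>
     (\<integral>\<^sup>+\<omega>. (\<Sum>t. ennreal (own (gameplay Sm Sp k \<omega> t) (Suc t))) \<partial>game_space)"

lemma exp_payoff_eq_ereal_iff:
  "exp_payoff own v_minus v_plus v_star Sm Sp k = ereal r \<longleftrightarrow>
     mean_stakes own Sm Sp k \<noteq> \<infinity> \<and>
     r = mean_terminal v_minus v_plus v_star Sm Sp k - enn2real (mean_stakes own Sm Sp k)"
  unfolding exp_payoff_def
  by (cases "mean_stakes own Sm Sp k" rule: ennreal_cases) auto

text \<open>Dynamic programming for payoffs. Finite continuation payoffs allow real arithmetic in
  place of extended subtraction. The separate argument \<open>own\<close> lets the same statement
  serve both players.\<close>

lemma exp_payoff_step:
  assumes S: "strategy Sm" "strategy Sp"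
    and sh: "\<And>i j. 0 < j \<Longrightarrow> Sm' i j = Sm i (Suc j)" "\<And>i j. 0 < j \<Longrightarrow> Sp' i j = Sp i (Suc j)"
      "\<And>i j. 0 < j \<Longrightarrow> own' i j = own i (Suc j)"
    and own: "0 \<le> own k 1"
    and u: "exp_payoff own' v_minus v_plus v_star Sm' Sp' (k + 1) = ereal u"
    and d: "exp_payoff own' v_minus v_plus v_star Sm' Sp' (k - 1) = ereal d"
  shows "exp_payoff own v_minus v_plus v_star Sm Sp k
    = ereal (up_prob Sm Sp k 1 * u + (1 - up_prob Sm Sp k 1) * d - own k 1)"
proof -
  let ?p = "up_prob Sm Sp k 1"
  obtain cu where cu: "0 \<le> cu" "mean_stakes own' Sm' Sp' (k + 1) = ennreal cu"
    "u = mean_terminal v_minus v_plus v_star Sm' Sp' (k + 1) - cu"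
    using u unfolding exp_payoff_eq_ereal_iff
    by (cases "mean_stakes own' Sm' Sp' (k + 1)" rule: ennreal_cases) auto
  obtain cd where cd: "0 \<le> cd" "mean_stakes own' Sm' Sp' (k - 1) = ennreal cd"
    "d = mean_terminal v_minus v_plus v_star Sm' Sp' (k - 1) - cd"
    using d unfolding exp_payoff_eq_ereal_iff
    by (cases "mean_stakes own' Sm' Sp' (k - 1)" rule: ennreal_cases) auto
  have p: "0 \<le> ?p" "?p \<le> 1" by (simp_all add: up_prob_bounds[OF S])
  have "mean_stakes own Sm Sp k = ennreal (own k 1) + ennreal ?p * ennreal cu + ennreal (1 - ?p) * ennreal cd"
    using nn_integral_stakes_step(1)[OF S sh(1,2), where own = "\<lambda>i j. ennreal (own i j)"
        and own' = "\<lambda>i j. ennreal (own' i j)" and k = k] sh(3) cu cd by simp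
  also have "\<dots> = ennreal (own k 1 + ?p * cu + (1 - ?p) * cd)"
    using p own cu(1) cd(1) by (simp add: ennreal_mult[symmetric] ennreal_plus[symmetric] del: ennreal_plus)
  finally have "mean_stakes own Sm Sp k = ennreal (own k 1 + ?p * cu + (1 - ?p) * cd)" .
  moreover have "mean_terminal v_minus v_plus v_star Sm Sp k
     = ?p * mean_terminal v_minus v_plus v_star Sm' Sp' (k + 1)
      + (1 - ?p) * mean_terminal v_minus v_plus v_star Sm' Sp' (k - 1)"
    by (rule integral_gameplay_step[OF S sh(1,2)]) (auto intro: abs_terminal_le simp: terminal_case_nat)
  moreover have "0 \<le> own k 1 + ?p * cu + (1 - ?p) * cd" using p own cu(1) cd(1) by simp
  ultimately show ?thesis
    unfolding exp_payoff_eq_ereal_iff cu(3) cd(3) by (simp add: algebra_simps)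
qed

section \<open>Supermartingale bounds and the identification of payoffs\<close>

lemma nn_integral_gameplay_supermartingale:
  fixes g :: "int \<Rightarrow> real"
  assumes "strategy Sm" "strategy Sp" "strategy own" and g: "\<And>i. 0 \<le> g i"
    and "\<And>i t. 0 < t \<Longrightarrow>
      up_prob Sm Sp i t * g (i + 1) + (1 - up_prob Sm Sp i t) * g (i - 1) \<le> g i + own i t"
  shows "(\<integral>\<^sup>+\<omega>. ennreal (g (gameplay Sm Sp k \<omega> T)) \<partial>game_space)
    \<le> ennreal (g k) + (\<integral>\<^sup>+\<omega>. (\<Sum>t<T. ennreal (own (gameplay Sm Sp k \<omega> t) (Suc t))) \<partial>game_space)"
  using assms(1-3,5)
proof (induction T arbitrary: k Sm Sp own)
  case 0
  interpret prob_space game_space by (rule prob_space_game_space)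
  show ?case by (simp add: emeasure_space_1)
next
  case (Suc T)
  let ?p = "up_prob Sm Sp k 1"
  \<comment> \<open>The induction peels off the first round instead of conditioning on the past.
    What remains is a game with shifted strategies, which is why the induction generalises over the
    strategies and the stakes.\<close>
  define Sm' Sp' own' where "Sm' i j = Sm i (Suc j)" and "Sp' i j = Sp i (Suc j)"
    and "own' i j = own i (Suc j)" for i j
  have p: "0 \<le> ?p" "?p \<le> 1" using Suc.prems by (simp_all add: up_prob_bounds)
  let ?C = "\<lambda>k. \<integral>\<^sup>+\<omega>. (\<Sum>t<T. ennreal (own' (gameplay Sm' Sp' k \<omega> t) (Suc t))) \<partial>game_space"
  have up: "up_prob Sm' Sp' i t = up_prob Sm Sp i (Suc t)" for i t
    by (simp add: up_prob_def Sm'_def Sp'_def)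
  have IH: "(\<integral>\<^sup>+\<omega>. ennreal (g (gameplay Sm' Sp' k \<omega> T)) \<partial>game_space) \<le> ennreal (g k) + ?C k" for k
    by (rule Suc.IH; (unfold up)?)
      (use Suc.prems in \<open>auto simp: strategy_def Sm'_def Sp'_def own'_def\<close>)
  have own: "0 \<le> own k 1" using Suc.prems by (auto simp: strategy_def)
  have "(\<integral>\<^sup>+\<omega>. ennreal (g (gameplay Sm Sp k \<omega> (Suc T))) \<partial>game_space)
    = ennreal ?p * (\<integral>\<^sup>+\<omega>. ennreal (g (gameplay Sm' Sp' (k + 1) \<omega> T)) \<partial>game_space)
    + ennreal (1 - ?p) * (\<integral>\<^sup>+\<omega>. ennreal (g (gameplay Sm' Sp' (k - 1) \<omega> T)) \<partial>game_space)"
    by (rule nn_integral_gameplay_Suc) (use Suc.prems in \<open>auto simp: Sm'_def Sp'_def\<close>)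
  also have "\<dots> \<le> ennreal ?p * (ennreal (g (k + 1)) + ?C (k + 1))
      + ennreal (1 - ?p) * (ennreal (g (k - 1)) + ?C (k - 1))"
    by (intro add_mono mult_left_mono IH) auto
  also have "\<dots> = (ennreal ?p * ennreal (g (k + 1)) + ennreal (1 - ?p) * ennreal (g (k - 1)))
      + (ennreal ?p * ?C (k + 1) + ennreal (1 - ?p) * ?C (k - 1))"
    by (simp add: distrib_left algebra_simps)
  also have "ennreal ?p * ennreal (g (k + 1)) + ennreal (1 - ?p) * ennreal (g (k - 1))
      = ennreal (?p * g (k + 1) + (1 - ?p) * g (k - 1))"
    using p g by (simp add: ennreal_mult[symmetric] ennreal_plus[symmetric] del: ennreal_plus)
  also have "\<dots> \<le> ennreal (g k + own k 1)"
    by (rule ennreal_leI) (use Suc.prems(4)[of 1 k] in simp)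
  also have "\<dots> = ennreal (g k) + ennreal (own k 1)"
    using own g by simp
  also have "ennreal (g k) + ennreal (own k 1) + (ennreal ?p * ?C (k + 1) + ennreal (1 - ?p) * ?C (k - 1))
    = ennreal (g k) + (ennreal (own k 1) + ennreal ?p * ?C (k + 1) + ennreal (1 - ?p) * ?C (k - 1))"
    by (simp add: add.assoc)
  also have "ennreal (own k 1) + ennreal ?p * ?C (k + 1) + ennreal (1 - ?p) * ?C (k - 1)
    = (\<integral>\<^sup>+\<omega>. (\<Sum>t<Suc T. ennreal (own (gameplay Sm Sp k \<omega> t) (Suc t))) \<partial>game_space)"
    by (rule nn_integral_stakes_step(2)[symmetric, where own = "\<lambda>i j. ennreal (own i j)"
        and own' = "\<lambda>i j. ennreal (own' i j)"])
      (use Suc.prems in \<open>auto simp: Sm'_def Sp'_def own'_def\<close>)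
  finally show ?case by (simp add: add_right_mono del: sum.lessThan_Suc gameplay.simps)
qed

text \<open>The same induction with reversed inequalities. Together with the supermartingale bound
  it yields the exact balance between mean value and mean stakes up to time \<open>T\<close> in the
  harmonic case.\<close>

lemma nn_integral_gameplay_submartingale:
  fixes g :: "int \<Rightarrow> real"
  assumes "strategy Sm" "strategy Sp" "strategy own" and g: "\<And>i. 0 \<le> g i"
    and "\<And>i t. 0 < t \<Longrightarrow>
      g i + own i t \<le> up_prob Sm Sp i t * g (i + 1) + (1 - up_prob Sm Sp i t) * g (i - 1)"
  shows "ennreal (g k) + (\<integral>\<^sup>+\<omega>. (\<Sum>t<T. ennreal (own (gameplay Sm Sp k \<omega> t) (Suc t))) \<partial>game_space)
    \<le> (\<integral>\<^sup>+\<omega>. ennreal (g (gameplay Sm Sp k \<omega> T)) \<partial>game_space)"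
  using assms(1-3,5)
proof (induction T arbitrary: k Sm Sp own)
  case 0
  interpret prob_space game_space by (rule prob_space_game_space)
  show ?case by (simp add: emeasure_space_1)
next
  case (Suc T)
  let ?p = "up_prob Sm Sp k 1"
  define Sm' Sp' own' where "Sm' i j = Sm i (Suc j)" and "Sp' i j = Sp i (Suc j)"
    and "own' i j = own i (Suc j)" for i j
  have p: "0 \<le> ?p" "?p \<le> 1" using Suc.prems by (simp_all add: up_prob_bounds)
  let ?C = "\<lambda>k. \<integral>\<^sup>+\<omega>. (\<Sum>t<T. ennreal (own' (gameplay Sm' Sp' k \<omega> t) (Suc t))) \<partial>game_space"
  have up: "up_prob Sm' Sp' i t = up_prob Sm Sp i (Suc t)" for i t
    by (simp add: up_prob_def Sm'_def Sp'_def)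
  have IH: "ennreal (g k) + ?C k \<le> (\<integral>\<^sup>+\<omega>. ennreal (g (gameplay Sm' Sp' k \<omega> T)) \<partial>game_space)" for k
    by (rule Suc.IH; (unfold up)?)
      (use Suc.prems in \<open>auto simp: strategy_def Sm'_def Sp'_def own'_def\<close>)
  have own: "0 \<le> own k 1" using Suc.prems by (auto simp: strategy_def)
  have "(\<integral>\<^sup>+\<omega>. (\<Sum>t<Suc T. ennreal (own (gameplay Sm Sp k \<omega> t) (Suc t))) \<partial>game_space)
    = ennreal (own k 1) + ennreal ?p * ?C (k + 1) + ennreal (1 - ?p) * ?C (k - 1)"
    by (rule nn_integral_stakes_step(2)[where own = "\<lambda>i j. ennreal (own i j)"
        and own' = "\<lambda>i j. ennreal (own' i j)"])
      (use Suc.prems in \<open>auto simp: Sm'_def Sp'_def own'_def\<close>)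
  then have "ennreal (g k) + (\<integral>\<^sup>+\<omega>. (\<Sum>t<Suc T. ennreal (own (gameplay Sm Sp k \<omega> t) (Suc t))) \<partial>game_space)
    = ennreal (g k + own k 1) + (ennreal ?p * ?C (k + 1) + ennreal (1 - ?p) * ?C (k - 1))"
    using own g by (simp add: add.assoc del: sum.lessThan_Suc gameplay.simps)
  also have "\<dots> \<le> ennreal (?p * g (k + 1) + (1 - ?p) * g (k - 1))
      + (ennreal ?p * ?C (k + 1) + ennreal (1 - ?p) * ?C (k - 1))"
    by (intro add_right_mono ennreal_leI) (use Suc.prems(4)[of 1 k] in simp)
  also have "ennreal (?p * g (k + 1) + (1 - ?p) * g (k - 1))
    = ennreal ?p * ennreal (g (k + 1)) + ennreal (1 - ?p) * ennreal (g (k - 1))"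
    using p g by (simp add: ennreal_mult[symmetric] ennreal_plus[symmetric] del: ennreal_plus)
  also have "\<dots> + (ennreal ?p * ?C (k + 1) + ennreal (1 - ?p) * ?C (k - 1))
      = ennreal ?p * (ennreal (g (k + 1)) + ?C (k + 1))
      + ennreal (1 - ?p) * (ennreal (g (k - 1)) + ?C (k - 1))"
    by (simp add: distrib_left algebra_simps)
  also have "\<dots> \<le> ennreal ?p * (\<integral>\<^sup>+\<omega>. ennreal (g (gameplay Sm' Sp' (k + 1) \<omega> T)) \<partial>game_space)
    + ennreal (1 - ?p) * (\<integral>\<^sup>+\<omega>. ennreal (g (gameplay Sm' Sp' (k - 1) \<omega> T)) \<partial>game_space)"
    by (intro add_mono mult_left_mono IH) auto
  also have "\<dots> = (\<integral>\<^sup>+\<omega>. ennreal (g (gameplay Sm Sp k \<omega> (Suc T))) \<partial>game_space)"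
    by (rule nn_integral_gameplay_Suc[symmetric]) (use Suc.prems in \<open>auto simp: Sm'_def Sp'_def\<close>)
  finally show ?case .
qed

text \<open>If the mean stakes are infinite, the payoff is minus infinity. Otherwise Fatou's lemma
  applies to \<open>f - v_star\<close>, which is nonnegative by \<open>low\<close>. On a path that
  does not escape, the terminal payment minus \<open>v_star\<close> is 0, so the pathwise bound by
  the liminf is trivial there.\<close>

lemma exp_payoff_le_superharmonic:
  fixes f :: "int \<Rightarrow> real"
  assumes S: "strategy Sm" "strategy Sp" "strategy own"
    and low: "\<And>i. v_star \<le> f i"
    and lim: "(\<lambda>k::nat. f (- int k)) \<longlonglongrightarrow> v_minus" "(\<lambda>k::nat. f (int k)) \<longlonglongrightarrow> v_plus"
    and step: "\<And>i t. 0 < t \<Longrightarrow>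
      up_prob Sm Sp i t * f (i + 1) + (1 - up_prob Sm Sp i t) * f (i - 1) \<le> f i + own i t"
  shows "exp_payoff own v_minus v_plus v_star Sm Sp k \<le> ereal (f k)"
proof (cases "mean_stakes own Sm Sp k" rule: ennreal_cases)
  case top
  then show ?thesis by (simp add: exp_payoff_def)
next
  case (real c)
  interpret prob_space game_space by (rule prob_space_game_space)
  let ?X = "gameplay Sm Sp k"
  let ?T = "terminal v_minus v_plus v_star"
  define g where "g i = f i - v_star" for i
  have v: "v_star \<le> v_minus" "v_star \<le> v_plus"
    using LIMSEQ_le_const[OF lim(1)] LIMSEQ_le_const[OF lim(2)] low by blast+
  have m [measurable]: "(\<lambda>\<omega>. G (?X \<omega> t)) \<in> borel_measurable game_space"
    for G :: "int \<Rightarrow> ennreal" and t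
    by (rule measurable_compose[OF measurable_gameplay_coord]) simp
  have "ennreal (?T (?X \<omega>) - v_star) \<le> liminf (\<lambda>T. ennreal (g (?X \<omega> T)))" for \<omega>
  proof -
    have *: "ennreal (v - v_star) \<le> liminf (\<lambda>T. ennreal (g (?X \<omega> T)))"
      if "(\<lambda>T. f (?X \<omega> T)) \<longlonglongrightarrow> v" for v
    proof -
      have "(\<lambda>T. ennreal (g (?X \<omega> T))) \<longlonglongrightarrow> ennreal (v - v_star)"
        unfolding g_def by (intro tendsto_ennrealI tendsto_diff that tendsto_const)
      then show ?thesis by (simp add: lim_imp_Liminf)
    qed
    show ?thesis
      using tendsto_along_int_path_at_bot[OF lim(1)] tendsto_along_int_path_at_top[OF lim(2)] *
      by (auto simp: terminal_filterlim)
  qed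
  then have "(\<integral>\<^sup>+\<omega>. ennreal (?T (?X \<omega>) - v_star) \<partial>game_space)
    \<le> (\<integral>\<^sup>+\<omega>. liminf (\<lambda>T. ennreal (g (?X \<omega> T))) \<partial>game_space)"
    by (intro nn_integral_mono)
  also have "\<dots> \<le> liminf (\<lambda>T. \<integral>\<^sup>+\<omega>. ennreal (g (?X \<omega> T)) \<partial>game_space)"
    by (rule nn_integral_liminf) (rule m)
  also have "\<dots> \<le> liminf (\<lambda>T::nat. ennreal (g k) + ennreal c)"
  proof (intro Liminf_mono always_eventually allI)
    fix T
    have "(\<integral>\<^sup>+\<omega>. ennreal (g (?X \<omega> T)) \<partial>game_space)
       \<le> ennreal (g k) + (\<integral>\<^sup>+\<omega>. (\<Sum>t<T. ennreal (own (?X \<omega> t) (Suc t))) \<partial>game_space)"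
      by (rule nn_integral_gameplay_supermartingale[OF S])
        (use low step in \<open>auto simp: g_def algebra_simps\<close>)
    also have "\<dots> \<le> ennreal (g k) + mean_stakes own Sm Sp k"
      by (intro add_left_mono nn_integral_mono sum_le_suminf) auto
    finally show "(\<integral>\<^sup>+\<omega>. ennreal (g (?X \<omega> T)) \<partial>game_space) \<le> ennreal (g k) + ennreal c"
      using real by simp
  qed
  also have "\<dots> = ennreal (g k + c)"
    using real low[of k] by (simp add: g_def Liminf_const)
  finally have "(\<integral>\<^sup>+\<omega>. ennreal (?T (?X \<omega>) - v_star) \<partial>game_space) \<le> ennreal (g k + c)" .
  moreover have "(\<integral>\<^sup>+\<omega>. ennreal (?T (?X \<omega>) - v_star) \<partial>game_space)
     = ennreal (mean_terminal v_minus v_plus v_star Sm Sp k - v_star)"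
    by (subst nn_integral_eq_integral)
      (use integrable_terminal_gameplay v in \<open>auto simp: prob_space terminal_def\<close>)
  ultimately have "ennreal (mean_terminal v_minus v_plus v_star Sm Sp k - v_star) \<le> ennreal (g k + c)"
    by simp
  moreover have "0 \<le> g k + c" using real low[of k] by (simp add: g_def)
  ultimately have "mean_terminal v_minus v_plus v_star Sm Sp k - v_star \<le> g k + c"
    using ennreal_le_iff by blast
  then show ?thesis
    using real by (simp add: exp_payoff_def g_def)
qed

lemma AE_gameplay_escapes:
  assumes c: "\<And>i. 0 < c i" and fin: "mean_stakes (\<lambda>i j. c i) Sm Sp k \<noteq> \<infinity>"
  shows "AE \<omega> in game_space. filterlim (gameplay Sm Sp k \<omega>) at_bot sequentially
    \<or> filterlim (gameplay Sm Sp k \<omega>) at_top sequentially"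
proof -
  have [measurable]: "(\<lambda>\<omega>. ennreal (c (gameplay Sm Sp k \<omega> t))) \<in> borel_measurable game_space" for t
    by (rule measurable_compose[OF measurable_gameplay_coord]) simp
  have "AE \<omega> in game_space. (\<Sum>t. ennreal (c (gameplay Sm Sp k \<omega> t))) \<noteq> \<infinity>"
    by (rule nn_integral_noteq_infinite) (use fin in auto)
  then show ?thesis
  proof eventually_elim
    case (elim \<omega>)
    show ?case
      by (rule finite_cost_path_escapes[where X = "gameplay Sm Sp k \<omega>" and c = c])
        (use elim c in auto)
  qed
qed

text \<open>The mean stakes up to time \<open>T\<close> equal the change in the mean of
  \<open>f\<close>, hence are at most \<open>2 * B\<close>; so the total is finite and the path
  escapes almost surely. Dominated convergence gives the value. \<open>v_star\<close> can be any
  real, since it is paid with probability 0.\<close>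

lemma exp_payoff_eq_harmonic:
  fixes f c :: "int \<Rightarrow> real"
  assumes S: "strategy Sm" "strategy Sp"
    and c: "\<And>i. 0 < c i" and bound: "\<And>i. \<bar>f i\<bar> \<le> B"
    and lim: "(\<lambda>k::nat. f (- int k)) \<longlonglongrightarrow> v_minus" "(\<lambda>k::nat. f (int k)) \<longlonglongrightarrow> v_plus"
    and step: "\<And>i t. 0 < t \<Longrightarrow>
      up_prob Sm Sp i t * f (i + 1) + (1 - up_prob Sm Sp i t) * f (i - 1) = f i + c i"
  shows "exp_payoff (\<lambda>i j. c i) v_minus v_plus v_star Sm Sp k = ereal (f k)"
proof -
  interpret prob_space game_space by (rule prob_space_game_space)
  let ?X = "gameplay Sm Sp k"
  define g where "g i = f i + B" for i
  define C where "C T = (\<integral>\<^sup>+\<omega>. (\<Sum>t<T. ennreal (c (?X \<omega> t))) \<partial>game_space)" for T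
  have own: "strategy (\<lambda>i j. c i)" using c by (auto simp: strategy_def intro: less_imp_le)
  have g: "0 \<le> g i" "g i \<le> 2 * B" for i using bound[of i] by (auto simp: g_def)
  have m [measurable]: "(\<lambda>\<omega>. ennreal (h (?X \<omega> t))) \<in> borel_measurable game_space"
    for h :: "int \<Rightarrow> real" and t
    by (rule measurable_compose[OF measurable_gameplay_coord]) simp
  have m' [measurable]: "(\<lambda>\<omega>. h (?X \<omega> t)) \<in> borel_measurable game_space"
    for h :: "int \<Rightarrow> real" and t
    by (rule measurable_compose[OF measurable_gameplay_coord]) simp
  have mart: "(\<integral>\<^sup>+\<omega>. ennreal (g (?X \<omega> T)) \<partial>game_space) = ennreal (g k) + C T" for T
    unfolding C_def
    by (intro antisym nn_integral_gameplay_supermartingale nn_integral_gameplay_submartingale S own)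
      (use g step in \<open>auto simp: g_def algebra_simps\<close>)
  have int: "integrable game_space (\<lambda>\<omega>. f (?X \<omega> T))" for T
    by (rule integrable_const_bound[where B = B]) (auto simp: bound)
  have le: "C T \<le> ennreal (2 * B)" for T
  proof -
    have "C T \<le> (\<integral>\<^sup>+\<omega>. ennreal (g (?X \<omega> T)) \<partial>game_space)" unfolding mart by simp
    also have "\<dots> \<le> (\<integral>\<^sup>+\<omega>. ennreal (2 * B) \<partial>game_space)"
      by (intro nn_integral_mono ennreal_leI g)
    finally show ?thesis by (simp add: emeasure_space_1)
  qed
  have lim_C: "C \<longlonglongrightarrow> mean_stakes (\<lambda>i j. c i) Sm Sp k"
    unfolding C_def by (simp add: nn_integral_sum nn_integral_suminf summable_LIMSEQ)
  then have "mean_stakes (\<lambda>i j. c i) Sm Sp k \<le> ennreal (2 * B)"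
    by (rule LIMSEQ_le_const2) (use le in auto)
  then obtain s where s: "0 \<le> s" "mean_stakes (\<lambda>i j. c i) Sm Sp k = ennreal s"
    by (cases "mean_stakes (\<lambda>i j. c i) Sm Sp k" rule: ennreal_cases) (auto simp: top_unique)
  have "(\<lambda>T. \<integral>\<omega>. f (?X \<omega> T) \<partial>game_space) \<longlonglongrightarrow> mean_terminal v_minus v_plus v_star Sm Sp k"
  proof (rule integral_dominated_convergence[where w = "\<lambda>_. B"])
    have "mean_stakes (\<lambda>i j. c i) Sm Sp k \<noteq> \<infinity>" using s by simp
    from AE_gameplay_escapes[OF c this]
    show "AE \<omega> in game_space. (\<lambda>T. f (?X \<omega> T)) \<longlonglongrightarrow> terminal v_minus v_plus v_star (?X \<omega>)"
    proof eventually_elim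
      case (elim \<omega>)
      then show ?case
        using tendsto_along_int_path_at_bot[OF lim(1), of "?X \<omega>"]
          tendsto_along_int_path_at_top[OF lim(2), of "?X \<omega>"]
        by (auto simp: terminal_filterlim)
    qed
    show "(\<lambda>\<omega>. terminal v_minus v_plus v_star (?X \<omega>)) \<in> borel_measurable game_space"
      by (rule measurable_compose[OF measurable_gameplay borel_measurable_terminal])
  qed (auto simp: bound)
  \<comment> \<open>The balance \<open>mart\<close>, read in real numbers once the shift by
    \<open>B\<close> is removed.\<close>
  moreover have "(\<integral>\<omega>. f (?X \<omega> T) \<partial>game_space) = f k + enn2real (C T)" for T
  proof -
    obtain x where x: "0 \<le> x" "C T = ennreal x"
      using le[of T] by (cases "C T" rule: ennreal_cases) (auto simp: top_unique)
    have "(\<integral>\<^sup>+\<omega>. ennreal (g (?X \<omega> T)) \<partial>game_space) = ennreal ((\<integral>\<omega>. f (?X \<omega> T) \<partial>game_space) + B)"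
      by (subst nn_integral_eq_integral) (use int g in \<open>auto simp: g_def prob_space\<close>)
    moreover have "0 \<le> (\<integral>\<omega>. f (?X \<omega> T) \<partial>game_space) + B"
    proof -
      have "0 \<le> (\<integral>\<omega>. g (?X \<omega> T) \<partial>game_space)" using g by simp
      then show ?thesis using int by (simp add: g_def prob_space)
    qed
    ultimately show ?thesis
      using mart[of T] x g[of k] unfolding g_def
      by (simp add: ennreal_plus[symmetric] del: ennreal_plus)
  qed
  moreover have "(\<lambda>T. f k + enn2real (C T)) \<longlonglongrightarrow> f k + s"
    using lim_C s by (intro tendsto_intros) auto
  ultimately have "mean_terminal v_minus v_plus v_star Sm Sp k = f k + s"
    by (simp add: LIMSEQ_unique)
  then show ?thesis using s by (simp add: exp_payoff_eq_ereal_iff)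
qed

section \<open>One round of the game\<close>

text \<open>The one-round game seen by either player: \<open>x\<close> is the own stake,
  \<open>y\<close> the opposing one. In the lemmas below \<open>u\<close> and \<open>d\<close> are
  the values after winning and losing, so Mina's case takes \<open>u = n (i - 1)\<close> and
  \<open>d = n (i + 1)\<close>.\<close>

definition win_prob :: "real \<Rightarrow> real \<Rightarrow> real" where
  "win_prob x y = (if x + y = 0 then 1/2 else x / (x + y))"

lemma up_prob_win_prob: "up_prob Sm Sp i t = win_prob (Sp i t) (Sm i t)"
  by (simp add: up_prob_def win_prob_def add.commute)

lemma one_minus_win_prob: "1 - win_prob x y = win_prob y x"
  by (cases "x + y = 0") (simp_all add: win_prob_def add.commute[of y x] diff_divide_eq_iff)

lemma win_prob_mix:
  assumes "0 < x + y"
  shows "win_prob x y * u + (1 - win_prob x y) * d = (x * u + y * d) / (x + y)"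
  using assms by (simp add: one_minus_win_prob) (simp add: win_prob_def add_divide_distrib add.commute)

text \<open>Both hypotheses are linear in \<open>u\<close> and \<open>d\<close>; solving them
  expresses the gaps to the neighbouring values through the stakes alone. The gaps are positive,
  which is the source of all monotonicity of value sequences.\<close>

lemma win_prob_best_response_value:
  assumes "0 < x" "0 < y" and val: "(x + y) * (v + x) = x * u + y * d"
    and opt: "(x + y)\<^sup>2 = y * (u - d)"
  shows "v - d = x\<^sup>2 / y" "u - v = 2 * x + y" "win_prob x y * u + (1 - win_prob x y) * d = v + x"
proof -
  have "(x + y) * (y * (v - d)) = (x + y) * x\<^sup>2"
    using val opt by algebra
  then have *: "y * (v - d) = x\<^sup>2" using assms by simp
  then show "v - d = x\<^sup>2 / y" using assms by (simp add: field_simps)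
  have "y * (u - v) = y * (2 * x + y)" using * opt by algebra
  then show "u - v = 2 * x + y" using assms by simp
  have "win_prob x y * u + (1 - win_prob x y) * d = (x * u + y * d) / (x + y)"
    using assms by (simp add: win_prob_mix)
  also have "\<dots> = v + x" using assms by (simp flip: val)
  finally show "win_prob x y * u + (1 - win_prob x y) * d = v + x" .
qed

text \<open>With the gaps inserted, the loss from staking \<open>s\<close> instead of
  \<open>x\<close>, multiplied by \<open>s + y\<close>, is the perfect square
  \<open>(s - x)^2\<close>.\<close>

lemma win_prob_best_response:
  assumes "0 < x" "0 < y" "0 \<le> s" and val: "(x + y) * (v + x) = x * u + y * d"
    and opt: "(x + y)\<^sup>2 = y * (u - d)"
  shows "win_prob s y * u + (1 - win_prob s y) * d \<le> v + s"
proof -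
  have u: "u = v + 2 * x + y" and d: "d = v - x\<^sup>2 / y"
    using win_prob_best_response_value[OF assms(1,2) val opt] by auto
  have "(v + s) * (s + y) - (s * u + y * d) = (s - x)\<^sup>2"
    using assms unfolding u d by (simp add: field_simps power2_eq_square)
  then have "s * u + y * d \<le> (v + s) * (s + y)"
    by (metis diff_ge_0_iff_ge zero_le_power2)
  then have "(s * u + y * d) / (s + y) \<le> v + s"
    using assms by (simp add: pos_divide_le_eq)
  also have "(s * u + y * d) / (s + y) = win_prob s y * u + (1 - win_prob s y) * d"
    using assms by (simp add: win_prob_mix)
  finally show ?thesis .
qed

text \<open>Against a zero stake every positive stake wins for certain, so halving a positive stake
  would save money.\<close>

lemma best_response_stake_zero:
  assumes v: "v = win_prob x y * u + (1 - win_prob x y) * d - x"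
    and best: "\<And>s. 0 \<le> s \<Longrightarrow> win_prob s y * u + (1 - win_prob s y) * d - s \<le> v"
    and "0 \<le> x" "y = 0"
  shows "x = 0"
proof (rule ccontr)
  assume "x \<noteq> 0"
  then have "0 < x" using assms by simp
  then show False using best[of "x / 2"] assms by (simp add: win_prob_def)
qed

text \<open>Two zero stakes toss a fair coin, while an arbitrarily small stake buys the outcome
  \<open>u\<close>; hence \<open>u <= v\<close>. As \<open>v\<close> is the midpoint of
  \<open>u\<close> and \<open>d\<close>, also \<open>v <= d\<close>.\<close>

lemma best_response_both_zero:
  assumes v: "v = win_prob 0 0 * u + (1 - win_prob 0 0) * d"
    and best: "\<And>s. 0 \<le> s \<Longrightarrow> win_prob s 0 * u + (1 - win_prob s 0) * d - s \<le> v"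
  shows "u \<le> v" "v \<le> d"
proof -
  have "u \<le> v + e" if "0 < e" for e
    using best[of e] that by (simp add: win_prob_def)
  then show "u \<le> v" by (rule field_le_epsilon)
  then show "v \<le> d" using v by (simp add: win_prob_def)
qed

text \<open>The value equation only restates \<open>v\<close>. The second equation is the
  first-order condition at the optimum \<open>x\<close>, obtained by showing that a quadratic in the
  stake has a double root there.\<close>

lemma best_response_positive:
  assumes v: "v = win_prob x y * u + (1 - win_prob x y) * d - x"
    and best: "\<And>s. 0 \<le> s \<Longrightarrow> win_prob s y * u + (1 - win_prob s y) * d - s \<le> v"
    and "0 < x" "0 < y"
  shows "(x + y) * (v + x) = x * u + y * d" "(x + y)\<^sup>2 = y * (u - d)"
proof -
  have w: "win_prob s y * u + (1 - win_prob s y) * d = (s * u + y * d) / (s + y)" if "0 \<le> s" for s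
    using that assms by (simp add: win_prob_mix)
  have vx: "v + x = (x * u + y * d) / (x + y)"
    using v w[of x] assms by simp
  then show val: "(x + y) * (v + x) = x * u + y * d"
    using assms by simp
  \<comment> \<open>The sum of the roots of \<open>(v + s) * (s + y) - (s * u + y * d)\<close> in
    \<open>s\<close> is \<open>u - v - y\<close>. Subtracting the root \<open>x\<close> and using
    the value equation gives this formula; \<open>r = x\<close> is the claim divided by
    \<open>x + y\<close>.\<close>
  define r where "r = y * (u - d) / (x + y) - y"
  have "r = x"
  proof (rule ccontr)
    assume "r \<noteq> x"
    \<comment> \<open>\<open>x\<close> and \<open>r\<close> are the roots of the quadratic \<open>(s - x) * (s - r)\<close>, which measures the loss
      of staking \<open>s\<close> instead of \<open>x\<close>; it is negative strictly between them.\<close>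
    define s where "s = (x + max r 0) / 2"
    have s: "0 \<le> s" using assms by (simp add: s_def)
    \<comment> \<open>Replacing \<open>r\<close> by \<open>max r 0\<close> keeps \<open>s\<close>
      nonnegative; since \<open>x\<close> is positive, \<open>s\<close> still lies strictly between
      \<open>x\<close> and \<open>r\<close>.\<close>
    have "x < s \<and> s < r \<or> s < x \<and> r < s"
      using \<open>r \<noteq> x\<close> assms(3) by (auto simp: s_def max_def)
    then have neg: "(s - x) * (s - r) < 0"
      by (auto simp: mult_less_0_iff)
    have "(s * u + y * d) / (s + y) \<le> v + s" using best[OF s] w[OF s] by simp
    then have "s * u + y * d \<le> (v + s) * (s + y)"
      using s \<open>0 < y\<close> by (simp add: pos_divide_le_eq)
    then have "(x + y) * (s * u + y * d) \<le> (x + y) * ((v + s) * (s + y))"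
      using assms by simp
    moreover have "(x + y) * r = y * (u - d) - y * (x + y)"
      using assms by (simp add: r_def field_simps)
    then have "(x + y) * ((v + s) * (s + y)) - (x + y) * (s * u + y * d)
      = (x + y) * ((s - x) * (s - r))"
      using val by algebra
    ultimately have "0 \<le> (x + y) * ((s - x) * (s - r))" by linarith
    moreover have "(x + y) * ((s - x) * (s - r)) < 0"
      using mult_pos_neg[OF _ neg, of "x + y"] assms(3,4) by simp
    ultimately show False by linarith
  qed
  then show "(x + y)\<^sup>2 = y * (u - d)"
    using assms by (simp add: r_def field_simps power2_eq_square)
qed

section \<open>Monotone sequences on the integers\<close>

lemma int_step_mono:
  fixes f :: "int \<Rightarrow> real"
  assumes "\<And>i. f i \<le> f (i + 1)"
  shows "i \<le> j \<Longrightarrow> f i \<le> f j"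
proof (induction j rule: int_ge_induct)
  case (step j)
  then show ?case using assms[of j] by simp
qed simp

lemma int_mono_limit_bounds:
  fixes f :: "int \<Rightarrow> real"
  assumes inc: "\<And>i. f i \<le> f (i + 1)"
    and lim: "(\<lambda>k::nat. f (- int k)) \<longlonglongrightarrow> l" "(\<lambda>k::nat. f (int k)) \<longlonglongrightarrow> u"
  shows "l \<le> f i" "f i \<le> u"
proof -
  have "\<forall>k\<ge>nat (- i). f (- int k) \<le> f i" using int_step_mono[of f, OF inc] by auto
  then show "l \<le> f i" using LIMSEQ_le_const2[OF lim(1)] by blast
  have "\<forall>k\<ge>nat i. f i \<le> f (int k)" using int_step_mono[of f, OF inc] by auto
  then show "f i \<le> u" using LIMSEQ_le_const[OF lim(2)] by blast
qed

lemma int_mono_bounded_limits: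
  fixes f :: "int \<Rightarrow> real"
  assumes inc: "\<And>i. f i \<le> f (i + 1)" and B: "\<And>i. \<bar>f i\<bar> \<le> B"
  obtains l u where "(\<lambda>k::nat. f (- int k)) \<longlonglongrightarrow> l" "(\<lambda>k::nat. f (int k)) \<longlonglongrightarrow> u"
proof -
  have "\<bar>f i\<bar> \<le> B" for i by (rule B)
  then have b: "f i \<le> B" "- B \<le> f i" for i by (simp_all add: abs_le_iff minus_le_iff)
  have "incseq (\<lambda>k::nat. f (int k))"
    by (auto simp: incseq_def intro: int_step_mono[of f, OF inc])
  then obtain u where "(\<lambda>k::nat. f (int k)) \<longlonglongrightarrow> u"
    using b(1) incseq_convergent by metis
  moreover have "decseq (\<lambda>k::nat. f (- int k))"
    by (auto simp: decseq_def intro: int_step_mono[of f, OF inc])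
  then obtain l where "(\<lambda>k::nat. f (- int k)) \<longlonglongrightarrow> l"
    using b(2) decseq_convergent by metis
  ultimately show ?thesis using that by blast
qed

section \<open>Positive ABMN solutions are equilibria\<close>

text \<open>Mina's equations are turned around so that her own stake comes first and
  \<open>n (i - 1)\<close> is her winning value, as the one-round lemmas expect.\<close>

lemma positive_ABMND:
  assumes "positive_ABMN a b m n"
  shows "0 < a i" "0 < b i"
    "(a i + b i) * (m i + a i) = a i * m (i + 1) + b i * m (i - 1)"
    "(a i + b i)\<^sup>2 = b i * (m (i + 1) - m (i - 1))"
    "(b i + a i) * (n i + b i) = b i * n (i - 1) + a i * n (i + 1)"
    "(b i + a i)\<^sup>2 = a i * (n (i - 1) - n (i + 1))"
  unfolding add.commute[of "b i" "a i"] add.commute[of "b i * n (i - 1)"]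
  using assms unfolding positive_ABMN_def ABMN_def by blast+

lemma positive_ABMN_bounds:
  assumes "positive_ABMN a b m n" and "boundary_data m n m_minf m_inf n_minf n_inf"
  shows "m_minf \<le> m i" "m i \<le> m_inf" "n_inf \<le> n i" "n i \<le> n_minf"
proof -
  note A = positive_ABMND[OF assms(1)]
  have m: "m i \<le> m (i + 1)" for i
  proof -
    have "m (i + 1) - m i = 2 * a i + b i"
      by (rule win_prob_best_response_value(2)) (use A in auto)
    then show ?thesis using A(1,2)[of i] by simp
  qed
  have n: "n (- i) \<le> n (- (i + 1))" for i
  proof -
    have "n (- i - 1) - n (- i) = 2 * b (- i) + a (- i)"
      by (rule win_prob_best_response_value(2)[where d = "n (- i + 1)"])
        (use A[of "- i"] in auto)
    then show ?thesis using A(1,2)[of "- i"] by simp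
  qed
  note lims = assms(2)[unfolded boundary_data_def]
  show "m_minf \<le> m i" "m i \<le> m_inf"
    using int_mono_limit_bounds[of m, OF m] lims by auto
  show "n_inf \<le> n i" "n i \<le> n_minf"
    using int_mono_limit_bounds[of "\<lambda>i. n (- i)" n_inf n_minf "- i", OF n] lims by auto
qed

lemma nash_equilibrium_of_positive_ABMN:
  assumes star: "m_star \<le> m_minf" "n_star \<le> n_inf"
    and pos: "positive_ABMN a b m n" and bd: "boundary_data m n m_minf m_inf n_minf n_inf"
  shows "nash_equilibrium m_minf m_inf n_minf n_inf m_star n_star (\<lambda>i j. b i) (\<lambda>i j. a i)"
proof -
  note A = positive_ABMND[OF pos]
  note lims = bd[unfolded boundary_data_def]
  note bounds = positive_ABMN_bounds[OF pos bd]
  have sa: "strategy (\<lambda>i j. a i)" and sb: "strategy (\<lambda>i j. b i)"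
    using A(1,2) by (auto simp: strategy_def intro: less_imp_le)
  have absm: "\<bar>m i\<bar> \<le> \<bar>m_minf\<bar> + \<bar>m_inf\<bar>" and absn: "\<bar>n i\<bar> \<le> \<bar>n_minf\<bar> + \<bar>n_inf\<bar>" for i
    using bounds[of i] by linarith+
  have m_val: "exp_payoff (\<lambda>i j. a i) m_minf m_inf m_star (\<lambda>i j. b i) (\<lambda>i j. a i) k = ereal (m k)" for k
  proof (rule exp_payoff_eq_harmonic[OF sb sa _ absm])
    fix i t
    show "up_prob (\<lambda>i j. b i) (\<lambda>i j. a i) i t * m (i + 1)
       + (1 - up_prob (\<lambda>i j. b i) (\<lambda>i j. a i) i t) * m (i - 1) = m i + a i"
      unfolding up_prob_win_prob by (rule win_prob_best_response_value(3)) (use A in auto)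
  qed (use A lims in auto)
  have n_val: "exp_payoff (\<lambda>i j. b i) n_minf n_inf n_star (\<lambda>i j. b i) (\<lambda>i j. a i) k = ereal (n k)" for k
  proof (rule exp_payoff_eq_harmonic[OF sb sa _ absn])
    fix i t
    have "win_prob (b i) (a i) * n (i - 1) + (1 - win_prob (b i) (a i)) * n (i + 1) = n i + b i"
      by (rule win_prob_best_response_value(3)) (use A in auto)
    then show "up_prob (\<lambda>i j. b i) (\<lambda>i j. a i) i t * n (i + 1)
       + (1 - up_prob (\<lambda>i j. b i) (\<lambda>i j. a i) i t) * n (i - 1) = n i + b i"
      unfolding up_prob_win_prob by (simp add: one_minus_win_prob add.commute)
  qed (use A lims in auto)
  \<comment> \<open>The lower bound needed for Fatou's lemma comes from
    \<open>m_star <= m_minf <= m i\<close>.\<close>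
  have m_dev: "exp_payoff S m_minf m_inf m_star (\<lambda>i j. b i) S k \<le> ereal (m k)"
    if S: "strategy S" for S k
  proof (rule exp_payoff_le_superharmonic[OF sb S S])
    fix i and t :: nat assume "0 < t"
    then have "0 \<le> S i t" using S by (simp add: strategy_def)
    then show "up_prob (\<lambda>i j. b i) S i t * m (i + 1) + (1 - up_prob (\<lambda>i j. b i) S i t) * m (i - 1)
        \<le> m i + S i t"
      unfolding up_prob_win_prob by (intro win_prob_best_response[where x = "a i"]) (use A in auto)
  qed (use lims bounds star order_trans in blast)+
  have n_dev: "exp_payoff S n_minf n_inf n_star S (\<lambda>i j. a i) k \<le> ereal (n k)"
    if S: "strategy S" for S k
  proof (rule exp_payoff_le_superharmonic[OF S sa S])
    fix i and t :: nat assume "0 < t"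
    then have "0 \<le> S i t" using S by (simp add: strategy_def)
    then have "win_prob (S i t) (a i) * n (i - 1) + (1 - win_prob (S i t) (a i)) * n (i + 1) \<le> n i + S i t"
      by (intro win_prob_best_response[where x = "b i"]) (use A in auto)
    then show "up_prob S (\<lambda>i j. a i) i t * n (i + 1) + (1 - up_prob S (\<lambda>i j. a i) i t) * n (i - 1)
        \<le> n i + S i t"
      unfolding up_prob_win_prob by (simp add: one_minus_win_prob add.commute)
  qed (use lims bounds star order_trans in blast)+
  show ?thesis
    unfolding nash_equilibrium_def maxine_payoff_def mina_payoff_def m_val n_val
    using m_dev n_dev by blast
qed

section \<open>Equilibria are positive ABMN solutions\<close>

lemma exp_payoff_le_mean_terminal:
  "exp_payoff own v_minus v_plus v_star Sm Sp k \<le> ereal (mean_terminal v_minus v_plus v_star Sm Sp k)"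
  unfolding exp_payoff_def
  by (cases "mean_stakes own Sm Sp k" rule: ennreal_cases) auto

lemma abs_mean_terminal_le:
  "\<bar>mean_terminal v_minus v_plus v_star Sm Sp k\<bar> \<le> \<bar>v_minus\<bar> + \<bar>v_plus\<bar> + \<bar>v_star\<bar>"
proof -
  interpret prob_space game_space by (rule prob_space_game_space)
  have "\<bar>mean_terminal v_minus v_plus v_star Sm Sp k\<bar>
    \<le> (\<integral>\<omega>. \<bar>terminal v_minus v_plus v_star (gameplay Sm Sp k \<omega>)\<bar> \<partial>game_space)"
    by (rule integral_abs_bound)
  also have "\<dots> \<le> (\<integral>\<omega>. \<bar>v_minus\<bar> + \<bar>v_plus\<bar> + \<bar>v_star\<bar> \<partial>game_space)"
    by (intro integral_mono integrable_abs integrable_terminal_gameplay abs_terminal_le) simp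
  finally show ?thesis by (simp add: prob_space)
qed

lemma exp_payoff_no_stakes:
  "exp_payoff (\<lambda>i j. 0) v_minus v_plus v_star Sm Sp k = ereal (mean_terminal v_minus v_plus v_star Sm Sp k)"
  by (simp add: exp_payoff_eq_ereal_iff)

text \<open>Staking nothing secures a bounded payoff, so an optimal payoff is not minus infinity;
  stakes being nonnegative bounds it from above. The bound later serves as the dominating
  constant.\<close>

lemma exp_payoff_finite_of_best:
  assumes "exp_payoff (\<lambda>i j. 0) v_minus v_plus v_star Sm' Sp' k \<le> exp_payoff own v_minus v_plus v_star Sm Sp k"
  obtains r where "exp_payoff own v_minus v_plus v_star Sm Sp k = ereal r"
    "\<bar>r\<bar> \<le> \<bar>v_minus\<bar> + \<bar>v_plus\<bar> + \<bar>v_star\<bar>"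
proof -
  let ?P = "exp_payoff own v_minus v_plus v_star Sm Sp k"
  have lo: "ereal (mean_terminal v_minus v_plus v_star Sm' Sp' k) \<le> ?P"
    using assms by (simp add: exp_payoff_no_stakes)
  have hi: "?P \<le> ereal (mean_terminal v_minus v_plus v_star Sm Sp k)"
    by (rule exp_payoff_le_mean_terminal)
  obtain r where r: "?P = ereal r" using lo hi by (cases ?P) auto
  have "\<bar>r\<bar> \<le> \<bar>v_minus\<bar> + \<bar>v_plus\<bar> + \<bar>v_star\<bar>"
    using lo hi abs_mean_terminal_le[of v_minus v_plus v_star Sm' Sp' k]
      abs_mean_terminal_le[of v_minus v_plus v_star Sm Sp k] unfolding r ereal_less_eq by linarith
  with r that show ?thesis by blast
qed

section \<open>Unopposed geometric stakes and the zero pair\<close>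

lemma AE_game_space_unit_interval: "AE \<omega> in game_space. \<forall>j. 0 \<le> \<omega> j \<and> \<omega> j < 1"
proof -
  \<comment> \<open>The value 1 must be excluded: with up probability 1 the path moves up only if
    the driving variable is strictly below 1.\<close>
  have "AE x in unit_uniform. 0 \<le> x \<and> x < 1"
  proof (rule AE_uniform_measureI)
    show "AE x in lborel. x \<in> {0..1::real} \<longrightarrow> 0 \<le> x \<and> x < 1"
      using AE_lborel_singleton[of "1::real"] by eventually_elim auto
  qed simp
  then show ?thesis
    unfolding game_space_def AE_all_countable
    by (auto intro!: AE_PiM_component prob_space_unit_uniform)
qed

lemma suminf_geometric_stakes:
  assumes "0 < e"
  shows "(\<Sum>t. ennreal (e * (1/2) ^ Suc t)) = ennreal e"
proof (rule suminf_ennreal_eq)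
  have "(\<lambda>t. e * (1/2) ^ Suc t) sums (e * 1)"
    by (intro sums_mult power_half_series)
  then show "(\<lambda>t. e * (1/2) ^ Suc t) sums e" by simp
qed (use assms in auto)

lemma exp_payoff_AE_terminal:
  assumes "AE \<omega> in game_space. terminal v_minus v_plus v_star (gameplay Sm Sp k \<omega>) = v"
    and "0 < e"
  shows "exp_payoff (\<lambda>i j. e * (1/2) ^ j) v_minus v_plus v_star Sm Sp k = ereal (v - e)"
proof -
  interpret prob_space game_space by (rule prob_space_game_space)
  have "mean_terminal v_minus v_plus v_star Sm Sp k = (\<integral>\<omega>. v \<partial>game_space)"
    by (rule integral_cong_AE)
      (use assms in \<open>auto intro: measurable_compose[OF measurable_gameplay borel_measurable_terminal]\<close>)
  moreover have "mean_stakes (\<lambda>i j. e * (1/2) ^ j) Sm Sp k = ennreal e"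
    unfolding suminf_geometric_stakes[OF assms(2)] by (simp add: emeasure_space_1)
  ultimately show ?thesis using assms(2) by (simp add: exp_payoff_eq_ereal_iff prob_space)
qed

text \<open>Stakes \<open>e / 2^j\<close> at time \<open>j\<close> sum to \<open>e\<close> on every
  path, yet each is positive and wins its round against nothing. They depend on time rather than on
  the site, so this strategy is not time-invariant.\<close>

lemma exp_payoff_unopposed_right:
  assumes e: "0 < e"
  shows "exp_payoff (\<lambda>i j. e * (1/2) ^ j) v_minus v_plus v_star (\<lambda>i j. 0) (\<lambda>i j. e * (1/2) ^ j) k
    = ereal (v_plus - e)"
proof (rule exp_payoff_AE_terminal[OF _ e])
  let ?X = "gameplay (\<lambda>i j. 0) (\<lambda>i j. e * (1/2) ^ j) k"
  show "AE \<omega> in game_space. terminal v_minus v_plus v_star (?X \<omega>) = v_plus"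
    using AE_game_space_unit_interval
  proof eventually_elim
    case (elim \<omega>)
    have X: "?X \<omega> t = k + int t" for t
      using elim e by (induction t) (auto simp: up_prob_def)
    have "filterlim (?X \<omega>) at_top sequentially"
      unfolding X filterlim_at_top eventually_sequentially
      by (metis add.commute diff_le_eq nat_le_iff)
    moreover have "\<not> filterlim (?X \<omega>) at_bot sequentially"
    proof
      assume "filterlim (?X \<omega>) at_bot sequentially"
      then have "\<forall>\<^sub>F t in sequentially. k + int t \<le> k - 1"
        unfolding X filterlim_at_bot by blast
      then show False by (auto simp: eventually_sequentially)
    qed
    ultimately show ?case by (simp add: terminal_filterlim)
  qed
qed

lemma exp_payoff_unopposed_left:
  assumes e: "0 < e"
  shows "exp_payoff (\<lambda>i j. e * (1/2) ^ j) v_minus v_plus v_star (\<lambda>i j. e * (1/2) ^ j) (\<lambda>i j. 0) k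
    = ereal (v_minus - e)"
proof (rule exp_payoff_AE_terminal[OF _ e])
  let ?X = "gameplay (\<lambda>i j. e * (1/2) ^ j) (\<lambda>i j. 0) k"
  show "AE \<omega> in game_space. terminal v_minus v_plus v_star (?X \<omega>) = v_minus"
    using AE_game_space_unit_interval
  proof eventually_elim
    case (elim \<omega>)
    have X: "?X \<omega> t = k - int t" for t
      using elim e by (induction t) (auto simp: up_prob_def not_less)
    have "filterlim (?X \<omega>) at_bot sequentially"
      unfolding X filterlim_at_bot eventually_sequentially
      by (metis add.commute diff_le_eq nat_le_iff)
    then show ?case by (simp add: terminal_filterlim)
  qed
qed

text \<open>Against zero stakes either player can secure almost the preferred payment at negligible
  cost. In an equilibrium both would have to receive that much, which exceeds what any single
  outcome pays jointly.\<close>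

lemma not_nash_equilibrium_zero_stakes:
  assumes "m_minf < m_inf" "n_inf < n_minf" "m_star \<le> m_minf" "n_star \<le> n_inf"
  shows "\<not> nash_equilibrium m_minf m_inf n_minf n_inf m_star n_star (\<lambda>i j. 0) (\<lambda>i j. 0)"
proof
  assume N: "nash_equilibrium m_minf m_inf n_minf n_inf m_star n_star (\<lambda>i j. 0) (\<lambda>i j. 0)"
  interpret prob_space game_space by (rule prob_space_game_space)
  let ?X = "gameplay (\<lambda>i j. 0) (\<lambda>i j. 0) 0"
  \<comment> \<open>No terminal outcome pays both players their best amount: \<open>K\<close> bounds the joint payment.\<close>
  define K where "K = max (m_minf + n_minf) (m_inf + n_inf)"
  \<comment> \<open>A quarter of the gap: after both deviations cost \<open>e\<close>, half of the
    gap remains.\<close>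
  define e where "e = (m_inf + n_minf - K) / 4"
  have e: "0 < e" using assms by (auto simp: e_def K_def)
  have S: "strategy (\<lambda>i j. e * (1/2) ^ j)" using e by (simp add: strategy_def)
  let ?M = "mean_terminal m_minf m_inf m_star (\<lambda>i j. 0) (\<lambda>i j. 0) 0"
  let ?N = "mean_terminal n_minf n_inf n_star (\<lambda>i j. 0) (\<lambda>i j. 0) 0"
  have "ereal (m_inf - e) \<le> ereal ?M"
    using N[unfolded nash_equilibrium_def maxine_payoff_def, rule_format, OF S, of 0, THEN conjunct1]
    unfolding exp_payoff_unopposed_right[OF e] exp_payoff_no_stakes .
  moreover have "ereal (n_minf - e) \<le> ereal ?N"
    using N[unfolded nash_equilibrium_def mina_payoff_def, rule_format, OF S, of 0, THEN conjunct2]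
    unfolding exp_payoff_unopposed_left[OF e] exp_payoff_no_stakes .
  moreover have "?M + ?N \<le> K"
  proof -
    have "?M + ?N = (\<integral>\<omega>. terminal m_minf m_inf m_star (?X \<omega>) + terminal n_minf n_inf n_star (?X \<omega>) \<partial>game_space)"
      by (simp add: integrable_terminal_gameplay)
    also have "\<dots> \<le> (\<integral>\<omega>. K \<partial>game_space)"
      by (intro integral_mono Bochner_Integration.integrable_add integrable_terminal_gameplay)
        (use assms in \<open>auto simp: terminal_def K_def\<close>)
    finally show ?thesis by (simp add: prob_space)
  qed
  ultimately have "m_inf + n_minf - 2 * e \<le> K" by simp
  then show False using e unfolding e_def by argo
qed

text \<open>On an escaping path \<open>terminal 0 1 0\<close> is the indicator of escape to the
  right and \<open>v_star\<close> is not paid, so mean terminal payments are affine in a single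
  escape probability.\<close>

lemma mean_terminal_escape_prob:
  assumes "AE \<omega> in game_space. filterlim (gameplay Sm Sp k \<omega>) at_bot sequentially
    \<or> filterlim (gameplay Sm Sp k \<omega>) at_top sequentially"
  shows "mean_terminal v_minus v_plus v_star Sm Sp k
    = v_minus + (v_plus - v_minus) * mean_terminal 0 1 0 Sm Sp k"
proof -
  interpret prob_space game_space by (rule prob_space_game_space)
  have "mean_terminal v_minus v_plus v_star Sm Sp k
    = (\<integral>\<omega>. v_minus + (v_plus - v_minus) * terminal 0 1 0 (gameplay Sm Sp k \<omega>) \<partial>game_space)"
  proof (rule integral_cong_AE)
    show "AE \<omega> in game_space. terminal v_minus v_plus v_star (gameplay Sm Sp k \<omega>)
        = v_minus + (v_plus - v_minus) * terminal 0 1 0 (gameplay Sm Sp k \<omega>)"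
      using assms by eventually_elim (auto simp: terminal_filterlim)
  qed (auto intro!: borel_measurable_add borel_measurable_times
      measurable_compose[OF measurable_gameplay borel_measurable_terminal])
  also have "\<dots> = v_minus + (v_plus - v_minus) * mean_terminal 0 1 0 Sm Sp k"
    by (simp add: integrable_terminal_gameplay prob_space)
  finally show ?thesis .
qed

lemma affine_eq_at_two_points:
  fixes h :: "'a \<Rightarrow> real"
  assumes "\<And>k. l + (u - l) * h k = l' + (u' - l') * h k" and "h i \<noteq> h j"
  shows "l = l'" "u = u'"
proof -
  have "((u - l) - (u' - l')) * (h i - h j) = 0"
    using assms(1)[of i] assms(1)[of j] by (simp add: algebra_simps)
  then have *: "u - l = u' - l'" using assms(2) by simp
  then show "l = l'" using assms(1)[of i] by simp
  with * show "u = u'" by simp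
qed

section \<open>Positivity and the ABMN equations at an equilibrium\<close>

lemma positive_ABMN_of_nash_equilibrium:
  assumes data: "m_minf < m_inf" "n_inf < n_minf" "m_star \<le> m_minf" "n_star \<le> n_inf"
    and nonneg: "\<And>i. 0 \<le> a i" "\<And>i. 0 \<le> b i"
    and N: "nash_equilibrium m_minf m_inf n_minf n_inf m_star n_star (\<lambda>i j. b i) (\<lambda>i j. a i)"
    and m: "\<And>i. exp_payoff (\<lambda>i j. a i) m_minf m_inf m_star (\<lambda>i j. b i) (\<lambda>i j. a i) i = ereal (m i)"
    and n: "\<And>i. exp_payoff (\<lambda>i j. b i) n_minf n_inf n_star (\<lambda>i j. b i) (\<lambda>i j. a i) i = ereal (n i)"
  shows "positive_ABMN a b m n"
proof -
  have sa: "strategy (\<lambda>i j. a i)" and sb: "strategy (\<lambda>i j. b i)"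
    using nonneg by (auto simp: strategy_def)
  note N = N[unfolded nash_equilibrium_def maxine_payoff_def mina_payoff_def m n, rule_format]
  have mval: "m i = win_prob (a i) (b i) * m (i + 1) + (1 - win_prob (a i) (b i)) * m (i - 1) - a i" for i
    using exp_payoff_step[OF sb sa _ _ _ _ m[of "i + 1"] m[of "i - 1"]] nonneg m[of i]
    by (simp add: up_prob_win_prob)
  have nval: "n i = win_prob (b i) (a i) * n (i - 1) + (1 - win_prob (b i) (a i)) * n (i + 1) - b i" for i
    using exp_payoff_step[OF sb sa _ _ _ _ n[of "i + 1"] n[of "i - 1"]] nonneg n[of i]
    by (simp add: up_prob_win_prob one_minus_win_prob add.commute)
  have mbest: "win_prob s (b i) * m (i + 1) + (1 - win_prob s (b i)) * m (i - 1) - s \<le> m i"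
    if "0 \<le> s" for s i
  proof -
    \<comment> \<open>A one-shot deviation: \<open>s\<close> at time 1, the equilibrium stakes
      afterwards. The continuation values are therefore still given by \<open>m\<close>.\<close>
    define S :: "int \<Rightarrow> nat \<Rightarrow> real" where "S i j = (if j = 1 then s else a i)" for i j
    have S: "strategy S" using that nonneg by (simp add: strategy_def S_def)
    have "exp_payoff S m_minf m_inf m_star (\<lambda>i j. b i) S i
      = ereal (up_prob (\<lambda>i j. b i) S i 1 * m (i + 1) + (1 - up_prob (\<lambda>i j. b i) S i 1) * m (i - 1) - S i 1)"
      by (rule exp_payoff_step[OF sb S _ _ _ _ m m]) (use that in \<open>auto simp: S_def\<close>)
    then show ?thesis using N[OF S, of i] by (simp add: up_prob_win_prob S_def)
  qed
  have nbest: "win_prob s (a i) * n (i - 1) + (1 - win_prob s (a i)) * n (i + 1) - s \<le> n i"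
    if "0 \<le> s" for s i
  proof -
    define S :: "int \<Rightarrow> nat \<Rightarrow> real" where "S i j = (if j = 1 then s else b i)" for i j
    have S: "strategy S" using that nonneg by (simp add: strategy_def S_def)
    have "exp_payoff S n_minf n_inf n_star S (\<lambda>i j. a i) i
      = ereal (up_prob S (\<lambda>i j. a i) i 1 * n (i + 1) + (1 - up_prob S (\<lambda>i j. a i) i 1) * n (i - 1) - S i 1)"
      by (rule exp_payoff_step[OF S sa _ _ _ _ n n]) (use that in \<open>auto simp: S_def\<close>)
    then show ?thesis using N[OF S, of i]
      by (simp add: up_prob_win_prob S_def one_minus_win_prob add.commute)
  qed
  have b0: "a i = 0" if "b i = 0" for i
    using best_response_stake_zero[OF mval mbest nonneg(1) that] .
  have a0: "b i = 0" if "a i = 0" for i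
    using best_response_stake_zero[OF nval nbest nonneg(2) that] .
  have zero: "m (i + 1) \<le> m i" "m i \<le> m (i - 1)" if "a i = 0" for i
    using best_response_both_zero[of "m i" "m (i + 1)" "m (i - 1)"] mval[of i] mbest[of _ i] that a0[OF that]
    by auto
  have pos: "(a i + b i) * (m i + a i) = a i * m (i + 1) + b i * m (i - 1)"
      "(a i + b i)\<^sup>2 = b i * (m (i + 1) - m (i - 1))"
      "(b i + a i) * (n i + b i) = b i * n (i - 1) + a i * n (i + 1)"
      "(b i + a i)\<^sup>2 = a i * (n (i - 1) - n (i + 1))"
      and inc: "m (i - 1) < m i" "m i < m (i + 1)"
    if "a i \<noteq> 0" for i
  proof -
    have ab: "0 < a i" "0 < b i" using that b0[of i] nonneg[of i] by (auto simp: less_le)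
    note mp = best_response_positive[OF mval mbest ab]
    note np = best_response_positive[OF nval nbest ab(2,1)]
    show "(a i + b i) * (m i + a i) = a i * m (i + 1) + b i * m (i - 1)"
      "(a i + b i)\<^sup>2 = b i * (m (i + 1) - m (i - 1))"
      "(b i + a i) * (n i + b i) = b i * n (i - 1) + a i * n (i + 1)"
      "(b i + a i)\<^sup>2 = a i * (n (i - 1) - n (i + 1))"
      using mp np by blast+
    have "m i - m (i - 1) = (a i)\<^sup>2 / b i" "m (i + 1) - m i = 2 * a i + b i"
      using win_prob_best_response_value[OF ab mp] by auto
    moreover have "0 < (a i)\<^sup>2 / b i" "0 < 2 * a i + b i" using ab by simp_all
    ultimately show "m (i - 1) < m i" "m i < m (i + 1)" by linarith+
  qed
  have "a i \<noteq> 0" for i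
  proof
    assume i: "a i = 0"
    \<comment> \<open>Zero stakes spread to neighbours: at a zero site \<open>m\<close> does not
      increase towards either adjacent site on the right or from the left, whereas at a site with
      positive stakes it increases strictly on both sides.\<close>
    have "a j = 0" for j
    proof (induction j rule: int_induct[where k = i])
      case base
      show ?case by (rule i)
    next
      case (step1 j)
      then show ?case using zero(1)[of j] inc(1)[of "j + 1"] by force
    next
      case (step2 j)
      then show ?case using zero(2)[of j] inc(2)[of "j - 1"] by force
    qed
    moreover from this a0 have "b j = 0" for j by blast
    ultimately show False
      using not_nash_equilibrium_zero_stakes[OF data] assms(7) by simp
  qed
  then show ?thesis
    using pos b0 nonneg unfolding positive_ABMN_def ABMN_def
    by (auto simp: less_le add.commute[of "b _" "a _"] add.commute[of "b _ * n _"])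
qed

section \<open>Boundary limits of the equilibrium values\<close>

lemma boundary_data_of_equilibrium_values:
  assumes pos: "positive_ABMN a b m n"
    and m: "\<And>i. exp_payoff (\<lambda>i j. a i) m_minf m_inf m_star (\<lambda>i j. b i) (\<lambda>i j. a i) i = ereal (m i)"
    and n: "\<And>i. exp_payoff (\<lambda>i j. b i) n_minf n_inf n_star (\<lambda>i j. b i) (\<lambda>i j. a i) i = ereal (n i)"
    and mB: "\<And>i. \<bar>m i\<bar> \<le> Bm" and nB: "\<And>i. \<bar>n i\<bar> \<le> Bn"
  shows "boundary_data m n m_minf m_inf n_minf n_inf"
proof -
  note A = positive_ABMND[OF pos]
  let ?Sm = "\<lambda>i j. b i" and ?Sp = "\<lambda>i j. a i"
  have sa: "strategy ?Sp" and sb: "strategy ?Sm"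
    using A(1,2) by (auto simp: strategy_def intro: less_imp_le)
  have minc: "m i < m (i + 1)" for i
    using win_prob_best_response_value(2)[OF A(1-4), of i] A(1,2)[of i] by simp
  have ninc: "n (i + 1) < n i" for i
  proof -
    have "n i - n (i + 1) = (b i)\<^sup>2 / a i"
      by (rule win_prob_best_response_value(1)) (use A in auto)
    moreover have "0 < (b i)\<^sup>2 / a i" using A(1,2)[of i] by simp
    ultimately show ?thesis by linarith
  qed
  have ninc': "n (- i) \<le> n (- (i + 1))" for i
    using ninc[of "- i - 1"] by simp
  obtain ml mu where ml: "(\<lambda>k::nat. m (- int k)) \<longlonglongrightarrow> ml" and mu: "(\<lambda>k::nat. m (int k)) \<longlonglongrightarrow> mu"
    using int_mono_bounded_limits[of m, OF less_imp_le[OF minc] mB] .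
  obtain nu nl where "(\<lambda>k::nat. n (- (- int k))) \<longlonglongrightarrow> nu" and nl: "(\<lambda>k::nat. n (- int k)) \<longlonglongrightarrow> nl"
    using int_mono_bounded_limits[of "\<lambda>i. n (- i)", OF ninc' nB] .
  then have nu: "(\<lambda>k::nat. n (int k)) \<longlonglongrightarrow> nu" by simp
  \<comment> \<open>The equilibrium value is also the payoff in the game whose terminal payments are
    the limits of \<open>m\<close> itself.\<close>
  have mh: "exp_payoff ?Sp ml mu m_star ?Sm ?Sp k = ereal (m k)" for k
  proof (rule exp_payoff_eq_harmonic[OF sb sa A(1) mB ml mu])
    fix i t
    show "up_prob ?Sm ?Sp i t * m (i + 1) + (1 - up_prob ?Sm ?Sp i t) * m (i - 1) = m i + a i"
      unfolding up_prob_win_prob by (rule win_prob_best_response_value(3)) (use A in auto)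
  qed
  have nh: "exp_payoff ?Sm nl nu n_star ?Sm ?Sp k = ereal (n k)" for k
  proof (rule exp_payoff_eq_harmonic[OF sb sa A(2) nB nl nu])
    fix i t
    have "win_prob (b i) (a i) * n (i - 1) + (1 - win_prob (b i) (a i)) * n (i + 1) = n i + b i"
      by (rule win_prob_best_response_value(3)) (use A in auto)
    then show "up_prob ?Sm ?Sp i t * n (i + 1) + (1 - up_prob ?Sm ?Sp i t) * n (i - 1) = n i + b i"
      unfolding up_prob_win_prob by (simp add: one_minus_win_prob add.commute)
  qed
  define h where "h k = mean_terminal 0 1 0 ?Sm ?Sp k" for k
  have esc: "mean_terminal v_minus v_plus v_star ?Sm ?Sp k = v_minus + (v_plus - v_minus) * h k"
    for v_minus v_plus v_star k
    unfolding h_def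
  proof (rule mean_terminal_escape_prob[OF AE_gameplay_escapes[OF A(1)]])
    show "mean_stakes ?Sp ?Sm ?Sp k \<noteq> \<infinity>" using m[of k] unfolding exp_payoff_eq_ereal_iff by simp
  qed
  \<comment> \<open>Both payoffs subtract the same mean stakes, so their mean terminal payments
    coincide.\<close>
  have mid: "ml + (mu - ml) * h k = m_minf + (m_inf - m_minf) * h k" for k
    using m[of k] mh[of k] unfolding exp_payoff_eq_ereal_iff esc by simp
  have nid: "nl + (nu - nl) * h k = n_minf + (n_inf - n_minf) * h k" for k
    using n[of k] nh[of k] unfolding exp_payoff_eq_ereal_iff esc by simp
  have "\<exists>i j. h i \<noteq> h j"
  proof (rule ccontr)
    assume "\<nexists>i j. h i \<noteq> h j"
    then have const: "h k = h 0" for k by blast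
    \<comment> \<open>A payoff never exceeds its mean terminal payment. If \<open>h\<close> is
      constant, the right-hand side is independent of \<open>k\<close>, and letting \<open>k\<close>
      tend to infinity forces \<open>h 0\<close> to be at least 1; for \<open>n\<close> the limit at
      minus infinity forces \<open>h 0\<close> to be at most 0.\<close>
    have "m k \<le> ml + (mu - ml) * h 0" for k
      using exp_payoff_le_mean_terminal[of ?Sp ml mu m_star ?Sm ?Sp k]
      unfolding mh esc const[of k] by simp
    then have "mu \<le> ml + (mu - ml) * h 0" by (intro LIMSEQ_le_const2[OF mu]) auto
    then have "0 \<le> (mu - ml) * (h 0 - 1)" by (simp add: algebra_simps)
    moreover have "ml < mu"
      using int_mono_limit_bounds[of m, OF less_imp_le[OF minc] ml mu] minc[of 0] by (meson le_less_trans less_le_trans)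
    ultimately have "1 \<le> h 0" by (simp add: zero_le_mult_iff)
    have "n k \<le> nl + (nu - nl) * h 0" for k
      using exp_payoff_le_mean_terminal[of ?Sm nl nu n_star ?Sm ?Sp k]
      unfolding nh esc const[of k] by simp
    then have "nl \<le> nl + (nu - nl) * h 0" by (intro LIMSEQ_le_const2[OF nl]) auto
    moreover have "nu < nl"
    proof -
      have "nu \<le> n 1" "n 0 \<le> nl"
        using int_mono_limit_bounds(1)[of "\<lambda>i. n (- i)" nu nl "- 1", OF ninc']
          int_mono_limit_bounds(2)[of "\<lambda>i. n (- i)" nu nl 0, OF ninc'] nl nu by simp_all
      then show ?thesis using ninc[of 0] by simp
    qed
    ultimately have "h 0 \<le> 0" by (simp add: zero_le_mult_iff)
    with \<open>1 \<le> h 0\<close> show False by simp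
  qed
  then obtain i j where "h i \<noteq> h j" by blast
  from affine_eq_at_two_points[of ml mu h, OF mid this] affine_eq_at_two_points[of nl nu h, OF nid this]
  show ?thesis using ml mu nl nu by (simp add: boundary_data_def)
qed

theorem mainTheorem3:
  fixes m_minf m_inf n_minf n_inf m_star n_star :: real
  assumes "m_minf < m_inf" and "n_inf < n_minf"
    and "m_star \<le> m_minf" and "n_star \<le> n_inf"
  shows
    "(\<forall>a b :: int \<Rightarrow> real.
        (\<forall>i. 0 \<le> a i \<and> 0 \<le> b i) \<longrightarrow>
        nash_equilibrium m_minf m_inf n_minf n_inf m_star n_star (\<lambda>i j. b i) (\<lambda>i j. a i) \<longrightarrow>
        (\<exists>m n :: int \<Rightarrow> real.
           (\<forall>i. maxine_payoff m_minf m_inf m_star (\<lambda>i j. b i) (\<lambda>i j. a i) i = ereal (m i) \<and>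
                mina_payoff n_minf n_inf n_star (\<lambda>i j. b i) (\<lambda>i j. a i) i = ereal (n i)) \<and>
           positive_ABMN a b m n \<and>
           boundary_data m n m_minf m_inf n_minf n_inf))
     \<and>
     (\<forall>a b m n :: int \<Rightarrow> real.
        positive_ABMN a b m n \<longrightarrow>
        boundary_data m n m_minf m_inf n_minf n_inf \<longrightarrow>
        nash_equilibrium m_minf m_inf n_minf n_inf m_star n_star (\<lambda>i j. b i) (\<lambda>i j. a i))"
proof (intro conjI allI impI)
  fix a b :: "int \<Rightarrow> real"
  assume nonneg: "\<forall>i. 0 \<le> a i \<and> 0 \<le> b i"
    and N: "nash_equilibrium m_minf m_inf n_minf n_inf m_star n_star (\<lambda>i j. b i) (\<lambda>i j. a i)"
  have zero: "strategy (\<lambda>i j. 0)" by (simp add: strategy_def)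
  \<comment> \<open>Comparison with the zero strategy makes the equilibrium payoffs real and
    bounded.\<close>
  note best = N[unfolded nash_equilibrium_def maxine_payoff_def mina_payoff_def, rule_format, OF zero]
  have "\<exists>r. exp_payoff (\<lambda>i j. a i) m_minf m_inf m_star (\<lambda>i j. b i) (\<lambda>i j. a i) i = ereal r
      \<and> \<bar>r\<bar> \<le> \<bar>m_minf\<bar> + \<bar>m_inf\<bar> + \<bar>m_star\<bar>" for i
    using exp_payoff_finite_of_best[OF best[THEN conjunct1]] by metis
  then obtain m where m: "\<And>i. exp_payoff (\<lambda>i j. a i) m_minf m_inf m_star (\<lambda>i j. b i) (\<lambda>i j. a i) i = ereal (m i)"
    and mB: "\<And>i. \<bar>m i\<bar> \<le> \<bar>m_minf\<bar> + \<bar>m_inf\<bar> + \<bar>m_star\<bar>" by metis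
  have "\<exists>r. exp_payoff (\<lambda>i j. b i) n_minf n_inf n_star (\<lambda>i j. b i) (\<lambda>i j. a i) i = ereal r
      \<and> \<bar>r\<bar> \<le> \<bar>n_minf\<bar> + \<bar>n_inf\<bar> + \<bar>n_star\<bar>" for i
    using exp_payoff_finite_of_best[OF best[THEN conjunct2]] by metis
  then obtain n where n: "\<And>i. exp_payoff (\<lambda>i j. b i) n_minf n_inf n_star (\<lambda>i j. b i) (\<lambda>i j. a i) i = ereal (n i)"
    and nB: "\<And>i. \<bar>n i\<bar> \<le> \<bar>n_minf\<bar> + \<bar>n_inf\<bar> + \<bar>n_star\<bar>" by metis
  have pos: "positive_ABMN a b m n"
    using positive_ABMN_of_nash_equilibrium[OF assms _ _ N m n] nonneg by blast
  moreover have "boundary_data m n m_minf m_inf n_minf n_inf"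
    by (rule boundary_data_of_equilibrium_values[OF pos m n mB nB])
  ultimately show "\<exists>m n :: int \<Rightarrow> real.
           (\<forall>i. maxine_payoff m_minf m_inf m_star (\<lambda>i j. b i) (\<lambda>i j. a i) i = ereal (m i) \<and>
                mina_payoff n_minf n_inf n_star (\<lambda>i j. b i) (\<lambda>i j. a i) i = ereal (n i)) \<and>
           positive_ABMN a b m n \<and> boundary_data m n m_minf m_inf n_minf n_inf"
    using m n unfolding maxine_payoff_def mina_payoff_def by blast
next
  fix a b m n :: "int \<Rightarrow> real"
  assume "positive_ABMN a b m n" "boundary_data m n m_minf m_inf n_minf n_inf"
  then show "nash_equilibrium m_minf m_inf n_minf n_inf m_star n_star (\<lambda>i j. b i) (\<lambda>i j. a i)"
    by (rule nash_equilibrium_of_positive_ABMN[OF assms(3,4)])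
qed

end
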